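(* Let $z\in\rho(A)$ be such that $k(z)\ne0$, and let $g\in Y$. Let $\{\phi_m\psi_n\}_{m,n\in\mathbb{N}}$ (with $(\phi_m\psi_n)(x,y)=\phi_m(x)\psi_n(y)$) form a basis of $L^2(\Omega)$ such that, for some $\rho_m,\nu_n\in\mathbb{C}$ with $k^2(z)\neq\rho_m^2$ and $k^2(z)\neq\nu_n^2$, $$L(z)\phi_m\psi_n=(k^2(z)-\rho_m^2)(k^2(z)-\nu_n^2)\phi_m\psi_n\quad\text{and}\quad(K(z)L(z)-L(z)K(z))\phi_m\psi_n=0$$ for all $m,n\in\mathbb{N}$, and let $g=\sum_{m,n}\xi_{m,n}\phi_m\psi_n$ be the expansion of $g$ in this basis. Then there exists a unique $q\in Y$ that solves $\Delta(z)q=g$, and it is given by $$q(x,y)=\frac{g(x,y)}{z+\alpha}+\frac{4c(z)k^2(z)}{z+\alpha}\sum_{m,n}\frac{\xi_{n,m}}{P_z(\rho_n,\nu_m)}\phi_n(x)\psi_m(y).$$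
   Context: Fix $a,b>0$, $\bar\Omega=[-a,a]\times[-b,b]$ with interior $\Omega$, and write $r=(x,y)\in\bar\Omega$, $\|r\|_1=|x|+|y|$. Let $Y=C(\bar\Omega)$ (continuous complex-valued functions, supremum norm). Fix reals $\alpha>0$, $\tau_0>0$, $S'(0)\ne0$ and complex numbers $\hat c\ne0$, $\xi$ such that $J(r,r')=\hat ce^{-\xi\|r-r'\|_1}$ is real-valued. Put $\tau_{max}=\tau_0+2a+2b$, $X=C([-\tau_{max},0];Y)$, and for $\varphi\in X$ $$(DG(0)\varphi)(r)=S'(0)\int_\Omega J(r,r')\varphi(-\tau_0-\|r-r'\|_1,r')\,dr'.$$ $A$ is the operator $A\varphi=\varphi'$ with domain $D(A)=\{\varphi\in X:\varphi'\in X,\ \varphi'(0)=-\alpha\varphi(0)+DG(0)\varphi\}$, with resolvent set $\rho(A)$; the essential spectrum of $A$ is $\{-\alpha\}$, so $-\alpha\notin\rho(A)$. For $z\in\mathbb{C}$ put $k(z)=z+\xi$, $c(z)=\hat cS'(0)e^{-\tau_0z}$ (so $c(z)\neq0$), $$(K(z)q)(r)=c(z)\int_\Omega e^{-k(z)\|r-r'\|_1}q(r')\,dr',\qquad\Delta(z)q=(z+\alpha)q-K(z)q,$$ $$L(z)q=\Bigl(k^2(z)-\frac{\partial^2}{\partial x^2}\Bigr)\Bigl(k^2(z)-\frac{\partial^2}{\partial y^2}\Bigr)q,\qquad P_z(\rho,\nu)=(z+\alpha)(k^2(z)-\rho^2)(k^2(z)-\nu^2)-4c(z)k^2(z).$$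 The functions $\phi_m\in C^2([-a,a])$, $\psi_n\in C^2([-b,b])$ are complex-valued. "Basis of $L^2(\Omega)$" means that every $f\in L^2(\Omega)$ has a unique expansion $f=\sum_{m,n}\xi_{m,n}\phi_m\psi_n$ with $\xi_{m,n}\in\mathbb{C}$, convergent in $L^2(\Omega)$; the series in the formula for $q$ is likewise understood in $L^2(\Omega)$. *)

theory Defs
  imports "HOL-Analysis.Analysis"
begin

abbreviation Omega :: "real \<Rightarrow> real \<Rightarrow> (real \<times> real) set" where
  "Omega a b \<equiv> box (- a, - b) (a, b)"

abbreviation Omega_bar :: "real \<Rightarrow> real \<Rightarrow> (real \<times> real) set" where
  "Omega_bar a b \<equiv> cbox (- a, - b) (a, b)"

definition norm1 :: "real \<times> real \<Rightarrow> real" where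
  "norm1 r = \<bar>fst r\<bar> + \<bar>snd r\<bar>"

text \<open>Elements of $C(\bar\Omega)$ are represented by total functions that take the value
  \<^const>\<open>undefined\<close> off $\bar\Omega$, so that equality in the set below is equality
  on $\bar\Omega$.  The same convention is used for $C([-\tau,0];Y)$.\<close>

definition Y_space :: "real \<Rightarrow> real \<Rightarrow> (real \<times> real \<Rightarrow> complex) set" where
  "Y_space a b = {q \<in> extensional (Omega_bar a b). continuous_on (Omega_bar a b) q}"

definition Y_norm :: "real \<Rightarrow> real \<Rightarrow> (real \<times> real \<Rightarrow> complex) \<Rightarrow> real" where
  "Y_norm a b q = (SUP r \<in> Omega_bar a b. norm (q r))"

definition X_space ::
  "real \<Rightarrow> real \<Rightarrow> real \<Rightarrow> (real \<Rightarrow> real \<times> real \<Rightarrow> complex) set" where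
  "X_space a b \<tau> = {\<phi> \<in> {- \<tau>..0} \<rightarrow>\<^sub>E Y_space a b.
     \<forall>\<theta>\<in>{- \<tau>..0}. ((\<lambda>s. Y_norm a b (\<lambda>r. \<phi> s r - \<phi> \<theta> r)) \<longlongrightarrow> 0) (at \<theta> within {- \<tau>..0})}"

definition X_norm ::
  "real \<Rightarrow> real \<Rightarrow> real \<Rightarrow> (real \<Rightarrow> real \<times> real \<Rightarrow> complex) \<Rightarrow> real" where
  "X_norm a b \<tau> \<phi> = (SUP \<theta> \<in> {- \<tau>..0}. Y_norm a b (\<phi> \<theta>))"

text \<open>The derivative of a $Y$-valued function on $[-\tau,0]$: difference quotients converge in
  the norm of $Y$, one-sidedly at the end points.\<close>

definition has_X_derivative ::
  "real \<Rightarrow> real \<Rightarrow> real \<Rightarrow> (real \<Rightarrow> real \<times> real \<Rightarrow> complex)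
    \<Rightarrow> (real \<Rightarrow> real \<times> real \<Rightarrow> complex) \<Rightarrow> bool" where
  "has_X_derivative a b \<tau> \<phi> \<phi>' \<longleftrightarrow>
     (\<forall>\<theta>\<in>{- \<tau>..0}.
       ((\<lambda>s. Y_norm a b (\<lambda>r. (\<phi> s r - \<phi> \<theta> r) / of_real (s - \<theta>) - \<phi>' \<theta> r)) \<longlongrightarrow> 0)
         (at \<theta> within {- \<tau>..0}))"

definition tau_max :: "real \<Rightarrow> real \<Rightarrow> real \<Rightarrow> real" where
  "tau_max a b \<tau>0 = \<tau>0 + 2 * a + 2 * b"

definition J :: "complex \<Rightarrow> complex \<Rightarrow> real \<times> real \<Rightarrow> real \<times> real \<Rightarrow> complex" where
  "J chat \<xi> r r' = chat * exp (- \<xi> * of_real (norm1 (r - r')))"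

text \<open>The real parameter \<open>dS\<close> stands for $S'(0)$.\<close>

definition DG0 ::
  "real \<Rightarrow> real \<Rightarrow> real \<Rightarrow> real \<Rightarrow> complex \<Rightarrow> complex
    \<Rightarrow> (real \<Rightarrow> real \<times> real \<Rightarrow> complex) \<Rightarrow> real \<times> real \<Rightarrow> complex" where
  "DG0 a b \<tau>0 dS chat \<xi> \<phi> r =
     of_real dS * (LINT r':Omega a b|lborel. J chat \<xi> r r' * \<phi> (- \<tau>0 - norm1 (r - r')) r')"

definition A_dom ::
  "real \<Rightarrow> real \<Rightarrow> real \<Rightarrow> real \<Rightarrow> real \<Rightarrow> complex \<Rightarrow> complex
    \<Rightarrow> (real \<Rightarrow> real \<times> real \<Rightarrow> complex) set" where
  "A_dom a b \<alpha> \<tau>0 dS chat \<xi> = {\<phi> \<in> X_space a b (tau_max a b \<tau>0).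
     \<exists>\<phi>' \<in> X_space a b (tau_max a b \<tau>0). has_X_derivative a b (tau_max a b \<tau>0) \<phi> \<phi>' \<and>
       (\<forall>r \<in> Omega_bar a b. \<phi>' 0 r = - of_real \<alpha> * \<phi> 0 r + DG0 a b \<tau>0 dS chat \<xi> \<phi> r)}"

definition A_op ::
  "real \<Rightarrow> real \<Rightarrow> real \<Rightarrow> (real \<Rightarrow> real \<times> real \<Rightarrow> complex)
    \<Rightarrow> (real \<Rightarrow> real \<times> real \<Rightarrow> complex)" where
  "A_op a b \<tau>0 \<phi> = (THE \<phi>'. \<phi>' \<in> X_space a b (tau_max a b \<tau>0) \<and>
     has_X_derivative a b (tau_max a b \<tau>0) \<phi> \<phi>')"

definition zI_minus_A ::
  "real \<Rightarrow> real \<Rightarrow> real \<Rightarrow> complex \<Rightarrow> (real \<Rightarrow> real \<times> real \<Rightarrow> complex)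
    \<Rightarrow> (real \<Rightarrow> real \<times> real \<Rightarrow> complex)" where
  "zI_minus_A a b \<tau>0 z \<phi> =
     (\<lambda>\<theta> \<in> {- tau_max a b \<tau>0..0}. \<lambda>r \<in> Omega_bar a b. z * \<phi> \<theta> r - A_op a b \<tau>0 \<phi> \<theta> r)"

definition A_resolvent_set ::
  "real \<Rightarrow> real \<Rightarrow> real \<Rightarrow> real \<Rightarrow> real \<Rightarrow> complex \<Rightarrow> complex \<Rightarrow> complex set" where
  "A_resolvent_set a b \<alpha> \<tau>0 dS chat \<xi> = {z.
     bij_betw (zI_minus_A a b \<tau>0 z) (A_dom a b \<alpha> \<tau>0 dS chat \<xi>) (X_space a b (tau_max a b \<tau>0)) \<and>
     (\<exists>M. \<forall>\<phi> \<in> A_dom a b \<alpha> \<tau>0 dS chat \<xi>.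
        X_norm a b (tau_max a b \<tau>0) \<phi> \<le> M * X_norm a b (tau_max a b \<tau>0) (zI_minus_A a b \<tau>0 z \<phi>))}"

definition k_fun :: "complex \<Rightarrow> complex \<Rightarrow> complex" where
  "k_fun \<xi> z = z + \<xi>"

definition c_fun :: "real \<Rightarrow> real \<Rightarrow> complex \<Rightarrow> complex \<Rightarrow> complex" where
  "c_fun \<tau>0 dS chat z = chat * of_real dS * exp (- of_real \<tau>0 * z)"

definition K_op ::
  "real \<Rightarrow> real \<Rightarrow> real \<Rightarrow> real \<Rightarrow> complex \<Rightarrow> complex \<Rightarrow> complex
    \<Rightarrow> (real \<times> real \<Rightarrow> complex) \<Rightarrow> real \<times> real \<Rightarrow> complex" where
  "K_op a b \<tau>0 dS chat \<xi> z q r =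
     c_fun \<tau>0 dS chat z *
     (LINT r':Omega a b|lborel. exp (- k_fun \<xi> z * of_real (norm1 (r - r'))) * q r')"

definition Delta_op ::
  "real \<Rightarrow> real \<Rightarrow> real \<Rightarrow> real \<Rightarrow> real \<Rightarrow> complex \<Rightarrow> complex \<Rightarrow> complex
    \<Rightarrow> (real \<times> real \<Rightarrow> complex) \<Rightarrow> real \<times> real \<Rightarrow> complex" where
  "Delta_op a b \<alpha> \<tau>0 dS chat \<xi> z q r =
     (z + of_real \<alpha>) * q r - K_op a b \<tau>0 dS chat \<xi> z q r"

text \<open>Derivatives are taken relative to the closed intervals, hence one-sidedly at the edges of
  $\bar\Omega$.  \<^const>\<open>vector_derivative\<close> is unspecified where no derivative exists, so
  these operators are meaningful only for functions for which all derivatives involved exist;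
  this holds for $\phi\psi$ and for $K(z)(\phi\psi)$ when $\phi,\psi$ are $C^2$.\<close>

definition d2x :: "real \<Rightarrow> (real \<times> real \<Rightarrow> complex) \<Rightarrow> real \<times> real \<Rightarrow> complex" where
  "d2x a q = (\<lambda>(x, y). vector_derivative
     (\<lambda>s. vector_derivative (\<lambda>t. q (t, y)) (at s within {- a..a})) (at x within {- a..a}))"

definition d2y :: "real \<Rightarrow> (real \<times> real \<Rightarrow> complex) \<Rightarrow> real \<times> real \<Rightarrow> complex" where
  "d2y b q = (\<lambda>(x, y). vector_derivative
     (\<lambda>s. vector_derivative (\<lambda>t. q (x, t)) (at s within {- b..b})) (at y within {- b..b}))"

definition L_op ::
  "real \<Rightarrow> real \<Rightarrow> complex \<Rightarrow> complex
    \<Rightarrow> (real \<times> real \<Rightarrow> complex) \<Rightarrow> real \<times> real \<Rightarrow> complex" where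
  "L_op a b \<xi> z q =
     (let w = (\<lambda>r. (k_fun \<xi> z)\<^sup>2 * q r - d2y b q r)
      in (\<lambda>r. (k_fun \<xi> z)\<^sup>2 * w r - d2x a w r))"

definition P_fun ::
  "real \<Rightarrow> real \<Rightarrow> real \<Rightarrow> complex \<Rightarrow> complex \<Rightarrow> complex \<Rightarrow> complex \<Rightarrow> complex \<Rightarrow> complex" where
  "P_fun \<alpha> \<tau>0 dS chat \<xi> z \<rho> \<nu> =
     (z + of_real \<alpha>) * ((k_fun \<xi> z)\<^sup>2 - \<rho>\<^sup>2) * ((k_fun \<xi> z)\<^sup>2 - \<nu>\<^sup>2)
     - 4 * c_fun \<tau>0 dS chat z * (k_fun \<xi> z)\<^sup>2"

definition C2_on :: "real set \<Rightarrow> (real \<Rightarrow> complex) \<Rightarrow> bool" where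
  "C2_on I f \<longleftrightarrow> (\<exists>f' f''.
     (\<forall>x\<in>I. (f has_vector_derivative f' x) (at x within I)) \<and>
     (\<forall>x\<in>I. (f' has_vector_derivative f'' x) (at x within I)) \<and>
     continuous_on I f'')"

text \<open>$L^2$ is handled through Borel representatives; every Lebesgue measurable function is
  almost everywhere equal to a Borel one.\<close>

definition L2 :: "(real \<times> real) set \<Rightarrow> (real \<times> real \<Rightarrow> complex) set" where
  "L2 S = {f. set_borel_measurable lborel S f \<and> set_integrable lborel S (\<lambda>r. (norm (f r))\<^sup>2)}"

definition L2_norm :: "(real \<times> real) set \<Rightarrow> (real \<times> real \<Rightarrow> complex) \<Rightarrow> real" where
  "L2_norm S f = sqrt (LINT r:S|lborel. (norm (f r))\<^sup>2)"

text \<open>A double series carries no canonical order of summation.  An order is therefore given by a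
  filter \<open>F\<close> on finite sets of index pairs along which every pair is eventually included:
  \<^term>\<open>finite_subsets_at_top UNIV\<close> itself is unconditional convergence, and
  enumerations, square and rectangular partial sums are image filters below it.\<close>

definition summation_order :: "(nat \<times> nat) set filter \<Rightarrow> bool" where
  "summation_order F \<longleftrightarrow> F \<noteq> bot \<and> F \<le> finite_subsets_at_top UNIV"

definition L2_sums ::
  "(nat \<times> nat) set filter \<Rightarrow> (real \<times> real) set
    \<Rightarrow> (nat \<Rightarrow> nat \<Rightarrow> real \<times> real \<Rightarrow> complex) \<Rightarrow> (real \<times> real \<Rightarrow> complex) \<Rightarrow> bool" where
  "L2_sums F S u f \<longleftrightarrow> (\<forall>m n. u m n \<in> L2 S) \<and> f \<in> L2 S \<and>
     ((\<lambda>N. L2_norm S (\<lambda>r. (\<Sum>(m, n)\<in>N. u m n r) - f r)) \<longlongrightarrow> 0) F"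

definition L2_basis ::
  "(nat \<times> nat) set filter \<Rightarrow> (real \<times> real) set
    \<Rightarrow> (nat \<Rightarrow> nat \<Rightarrow> real \<times> real \<Rightarrow> complex) \<Rightarrow> bool" where
  "L2_basis F S e \<longleftrightarrow> (\<forall>m n. e m n \<in> L2 S) \<and>
     (\<forall>f \<in> L2 S. \<exists>!\<eta> :: nat \<Rightarrow> nat \<Rightarrow> complex. L2_sums F S (\<lambda>m n r. \<eta> m n * e m n r) f)"

definition tensor :: "(real \<Rightarrow> complex) \<Rightarrow> (real \<Rightarrow> complex) \<Rightarrow> real \<times> real \<Rightarrow> complex" where
  "tensor f h = (\<lambda>(x, y). f x * h y)"

end

theory Submission
  imports Defs
begin

text \<open>The argument has two independent halves.

  The first half transfers membership in the resolvent set of \<open>A\<close> to the characteristic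
  operator.  If $\Delta(z)q=0$, then $e^{z\theta}q$ is an eigenfunction of \<open>A\<close>, so $\Delta(z)$ is
  injective on $Y$ (\<open>Delta_injective_on_resolvent_set\<close>).  To solve $\Delta(z)q=g$, one solves
  $(z-A)\varphi=f$ for an inhomogeneity \<open>f\<close> whose contribution to $\varphi$ has died out on the
  time interval that the delayed term observes; then $q=\varphi(0)$ works
  (\<open>Delta_surjective_on_resolvent_set\<close>).  Surjectivity also excludes $z=-\alpha$, where
  $\Delta(z)=-K(z)$ has only functions differentiable in \<open>x\<close> in its range
  (\<open>resolvent_set_avoids_minus_alpha\<close>).

  The second half diagonalizes $K(z)$.  Its kernel is a multiple of a Green function of $L(z)$:
  $L(z)K(z)q=4c(z)k^2(z)q$ for every continuous \<open>q\<close> (\<open>L_op_K_op\<close>).  An eigenfunction of $L(z)$ with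
  eigenvalue $l\neq0$ on which $K(z)$ and $L(z)$ commute is thus an eigenfunction of $K(z)$ with
  eigenvalue $4c(z)k^2(z)/l$, and of $\Delta(z)$ with eigenvalue $P_z/l$ (\<open>K_op_eigenvalue\<close>).  By
  injectivity $P_z\neq0$.

  Expand the solution \<open>q\<close> in the basis with coefficients $\eta_{m,n}$.  Since $K(z)$ is bounded on
  $L^2(\Omega)$, it may be applied term by term (\<open>K_op_L2_sums\<close>), and uniqueness of the expansion
  of $g=\Delta(z)q$ gives $\xi_{m,n}=\eta_{m,n}P_z/l$.  Hence
  $K(z)q=4c(z)k^2(z)\sum\xi_{m,n}\phi_m\psi_n/P_z$, and $q=(g+K(z)q)/(z+\alpha)$ is the asserted
  formula.\<close>

section \<open>Convolution with the exponential kernel on an interval\<close>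

lemma set_integral_box_continuous:
  fixes f :: "'a::euclidean_space \<Rightarrow> complex"
  assumes "continuous_on (cbox p q) f"
  shows "set_integrable lborel (box p q) f"
    and "(LINT x:box p q|lborel. f x) = integral (cbox p q) f"
proof -
  have "set_integrable lborel (cbox p q) f"
    unfolding set_integrable_def by (rule borel_integrable_compact[OF compact_cbox assms])
  then show 1: "set_integrable lborel (box p q) f"
    by (rule set_integrable_subset) (auto simp: box_subset_cbox)
  show "(LINT x:box p q|lborel. f x) = integral (cbox p q) f"
    by (simp add: set_borel_integral_eq_integral(2)[OF 1] integral_open_interval)
qed

text \<open>The one-dimensional factor of $K(z)$: the kernel $e^{-k\|r-r'\|_1}$ is the product of one
  such kernel in each coordinate.\<close>
definition exp_conv :: "complex \<Rightarrow> real \<Rightarrow> (real \<Rightarrow> complex) \<Rightarrow> real \<Rightarrow> complex" where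
  "exp_conv k a u x = integral {- a..a} (\<lambda>t. exp (- k * of_real \<bar>x - t\<bar>) * u t)"

text \<open>Cutting the integral at \<open>x\<close> removes the absolute value, and each half becomes an
  exponential in \<open>x\<close> times an indefinite integral, which the fundamental theorem of calculus
  differentiates.\<close>
lemma exp_conv_split:
  assumes u: "continuous_on {- a..a} u" and x: "x \<in> {- a..a}"
  shows "exp_conv k a u x =
     exp (- k * of_real x) * integral {- a..x} (\<lambda>t. exp (k * of_real t) * u t)
   + exp (k * of_real x) * integral {x..a} (\<lambda>t. exp (- k * of_real t) * u t)"
proof -
  let ?f = "\<lambda>t. exp (- k * of_real \<bar>x - t\<bar>) * u t"
  have "continuous_on {- a..a} ?f" by (intro continuous_intros u)
  then have "?f integrable_on {- a..a}" by (rule integrable_continuous_real)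
  then have "exp_conv k a u x = integral {- a..x} ?f + integral {x..a} ?f"
    unfolding exp_conv_def using x
    by (intro Henstock_Kurzweil_Integration.integral_combine[symmetric]) auto
  also have "integral {- a..x} ?f =
      integral {- a..x} (\<lambda>t. exp (- k * of_real x) * (exp (k * of_real t) * u t))"
    unfolding mult.assoc[symmetric] exp_add[symmetric]
    by (rule Henstock_Kurzweil_Integration.integral_cong) (simp add: algebra_simps)
  also have "\<dots> = exp (- k * of_real x) * integral {- a..x} (\<lambda>t. exp (k * of_real t) * u t)"
    by simp
  also have "integral {x..a} ?f =
      integral {x..a} (\<lambda>t. exp (k * of_real x) * (exp (- k * of_real t) * u t))"
    unfolding mult.assoc[symmetric] exp_add[symmetric]
    by (rule Henstock_Kurzweil_Integration.integral_cong) (simp add: algebra_simps)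
  also have "\<dots> = exp (k * of_real x) * integral {x..a} (\<lambda>t. exp (- k * of_real t) * u t)"
    by simp
  finally show ?thesis .
qed

lemma has_vector_derivative_exp:
  "((\<lambda>x. exp (k * of_real x)) has_vector_derivative k * exp (k * of_real x)) (at x within S)"
  for k :: complex
proof -
  have "((\<lambda>w. exp (k * w)) has_field_derivative k * exp (k * of_real x)) (at (of_real x))"
    by (auto intro!: derivative_eq_intros)
  then show ?thesis
    by (intro has_vector_derivative_real_field)
qed

text \<open>The kernel $e^{-k|x-t|}$ is $2k$ times a Green function of
  $k^2-\partial_x^2$: in the first derivative the two boundary terms cancel, in the second they
  add up to $-2ku$.\<close>
lemma exp_conv_second_derivative:
  assumes u: "continuous_on {- a..a} u"
  obtains v where
    "\<And>x. x \<in> {- a..a} \<Longrightarrow> (exp_conv k a u has_vector_derivative v x) (at x within {- a..a})"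
    "\<And>x. x \<in> {- a..a} \<Longrightarrow>
       (v has_vector_derivative k\<^sup>2 * exp_conv k a u x - 2 * k * u x) (at x within {- a..a})"
proof -
  define A where "A x = integral {- a..x} (\<lambda>t. exp (k * of_real t) * u t)" for x
  define B where "B x = integral {x..a} (\<lambda>t. exp (- k * of_real t) * u t)" for x
  define v where "v x = - k * exp (- k * of_real x) * A x + k * exp (k * of_real x) * B x" for x
  have dA: "(A has_vector_derivative exp (k * of_real x) * u x) (at x within {- a..a})"
    if "x \<in> {- a..a}" for x
    unfolding A_def by (rule integral_has_vector_derivative[OF _ that]) (intro continuous_intros u)
  have dB: "(B has_vector_derivative - (exp (- k * of_real x) * u x)) (at x within {- a..a})"
    if "x \<in> {- a..a}" for x
    unfolding B_def by (rule integral_has_vector_derivative'[OF _ that]) (intro continuous_intros u)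
  have eq: "exp_conv k a u x = exp (- k * of_real x) * A x + exp (k * of_real x) * B x"
    if "x \<in> {- a..a}" for x
    unfolding A_def B_def by (rule exp_conv_split[OF u that])
  have inv: "exp (- k * of_real x) * exp (k * of_real x) = 1" for x
    by (simp add: exp_add[symmetric])
  have ring: "- k * e * (E * w) + - k * (- k * e) * p + (k * E * (- (e * w)) + k * (k * E) * p')
      = k\<^sup>2 * (e * p + E * p') - 2 * k * w" if "e * E = 1" for e E w p p' :: complex
    using that by algebra
  show ?thesis
  proof (rule that)
    fix x assume x: "x \<in> {- a..a}"
    have "((\<lambda>x. exp (- k * of_real x) * A x + exp (k * of_real x) * B x) has_vector_derivative
        (exp (- k * of_real x) * (exp (k * of_real x) * u x) + - k * exp (- k * of_real x) * A x)
      + (exp (k * of_real x) * (- (exp (- k * of_real x) * u x)) + k * exp (k * of_real x) * B x))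
      (at x within {- a..a})"
      by (intro has_vector_derivative_add has_vector_derivative_mult has_vector_derivative_exp dA dB x)
    moreover have "(exp (- k * of_real x) * (exp (k * of_real x) * u x) + - k * exp (- k * of_real x) * A x)
      + (exp (k * of_real x) * (- (exp (- k * of_real x) * u x)) + k * exp (k * of_real x) * B x) = v x"
      by (simp add: v_def algebra_simps)
    ultimately show "(exp_conv k a u has_vector_derivative v x) (at x within {- a..a})"
      using has_vector_derivative_transform[OF x eq] by simp
    have "(v has_vector_derivative
        (- k * exp (- k * of_real x) * (exp (k * of_real x) * u x)
          + - k * (- k * exp (- k * of_real x)) * A x)
      + (k * exp (k * of_real x) * (- (exp (- k * of_real x) * u x))
          + k * (k * exp (k * of_real x)) * B x))
      (at x within {- a..a})"
      unfolding v_def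
      by (intro has_vector_derivative_add has_vector_derivative_mult
          has_vector_derivative_mult_right has_vector_derivative_exp dA dB x)
    moreover have "(- k * exp (- k * of_real x) * (exp (k * of_real x) * u x)
          + - k * (- k * exp (- k * of_real x)) * A x)
      + (k * exp (k * of_real x) * (- (exp (- k * of_real x) * u x))
          + k * (k * exp (k * of_real x)) * B x) = k\<^sup>2 * exp_conv k a u x - 2 * k * u x"
      unfolding eq[OF x] by (rule ring[OF inv])
    ultimately show
      "(v has_vector_derivative k\<^sup>2 * exp_conv k a u x - 2 * k * u x) (at x within {- a..a})"
      by simp
  qed
qed

text \<open>The form in which the previous lemma meets \<^const>\<open>d2x\<close> and \<^const>\<open>d2y\<close>.
  It is stated for functions \<open>f\<close> that agree with a multiple of the convolution on the closed
  interval only, because the relative derivatives do not see other values.\<close>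
lemma iterated_vector_derivative_exp_conv:
  assumes a: "a > 0" and u: "continuous_on {- a..a} u" and x: "x \<in> {- a..a}"
    and f: "\<And>x. x \<in> {- a..a} \<Longrightarrow> f x = C * exp_conv k a u x"
  shows "vector_derivative (\<lambda>s. vector_derivative f (at s within {- a..a})) (at x within {- a..a})
    = k\<^sup>2 * f x - 2 * k * C * u x"
proof -
  obtain v where v: "\<And>x. x \<in> {- a..a} \<Longrightarrow>
      (exp_conv k a u has_vector_derivative v x) (at x within {- a..a})"
    "\<And>x. x \<in> {- a..a} \<Longrightarrow>
       (v has_vector_derivative k\<^sup>2 * exp_conv k a u x - 2 * k * u x) (at x within {- a..a})"
    using exp_conv_second_derivative[OF u] by metis
  note vd = vector_derivative_within_cbox[of "- a" a, unfolded cbox_interval]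
  have 1: "vector_derivative f (at s within {- a..a}) = C * v s" if s: "s \<in> {- a..a}" for s
    using a s by (intro vd has_vector_derivative_transform[OF s f]
        has_vector_derivative_mult_right v) auto
  have "vector_derivative (\<lambda>s. vector_derivative f (at s within {- a..a})) (at x within {- a..a})
    = C * (k\<^sup>2 * exp_conv k a u x - 2 * k * u x)"
    using a x by (intro vd has_vector_derivative_transform[OF x 1]
        has_vector_derivative_mult_right v) auto
  then show ?thesis using f[OF x] by (simp add: algebra_simps)
qed

section \<open>The integral operator and its differential left inverse\<close>

lemma Omega_imp_Omega_bar: "r \<in> Omega a b \<Longrightarrow> r \<in> Omega_bar a b"
  using box_subset_cbox by blast

lemma continuous_on_section:
  assumes q: "continuous_on (Omega_bar a b) q" and y: "y \<in> {- b..b}"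
  shows "continuous_on {- a..a} (\<lambda>s. q (s, y))"
  using y
  by (auto intro!: continuous_on_compose2[OF q] continuous_intros simp: cbox_Pair_eq)

lemma continuous_on_exp_conv_section:
  assumes q: "continuous_on (Omega_bar a b) q"
  shows "continuous_on {- b..b} (\<lambda>t. exp_conv k a (\<lambda>s. q (s, t)) x)"
    and "continuous_on {- a..a} (\<lambda>s. exp_conv k b (\<lambda>t. q (s, t)) y)"
proof -
  have "continuous_on ({- b..b} \<times> cbox (- a) a)
      (\<lambda>(t, s). exp (- k * of_real \<bar>x - s\<bar>) * q (s, t))"
    unfolding split_beta
    by (intro continuous_intros continuous_on_compose2[OF q]) (auto simp: cbox_Pair_eq)
  from integral_continuous_on_param[OF this]
  show "continuous_on {- b..b} (\<lambda>t. exp_conv k a (\<lambda>s. q (s, t)) x)"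
    unfolding exp_conv_def by simp
  have "continuous_on ({- a..a} \<times> cbox (- b) b)
      (\<lambda>(s, t). exp (- k * of_real \<bar>y - t\<bar>) * q (s, t))"
    unfolding split_beta
    by (intro continuous_intros continuous_on_compose2[OF q]) (auto simp: cbox_Pair_eq)
  from integral_continuous_on_param[OF this]
  show "continuous_on {- a..a} (\<lambda>s. exp_conv k b (\<lambda>t. q (s, t)) y)"
    unfolding exp_conv_def by simp
qed

lemma continuous_on_kernel:
  "continuous_on S (\<lambda>r'. exp (- k * of_real (norm1 (r - r'))) :: complex)"
  unfolding norm1_def by (intro continuous_intros)

text \<open>Fubini's theorem, in both orders: the \<open>x\<close>-convolution is outermost when differentiating
  in \<open>x\<close>, the \<open>y\<close>-convolution when differentiating in \<open>y\<close>.\<close>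
lemma K_op_iterated:
  assumes q: "continuous_on (Omega_bar a b) q"
  shows "K_op a b \<tau>0 dS chat \<xi> z q (x, y) = c_fun \<tau>0 dS chat z *
      exp_conv (k_fun \<xi> z) a (\<lambda>s. exp_conv (k_fun \<xi> z) b (\<lambda>t. q (s, t)) y) x" (is ?A)
    and "K_op a b \<tau>0 dS chat \<xi> z q (x, y) = c_fun \<tau>0 dS chat z *
      exp_conv (k_fun \<xi> z) b (\<lambda>t. exp_conv (k_fun \<xi> z) a (\<lambda>s. q (s, t)) x) y" (is ?B)
proof -
  define k where "k = k_fun \<xi> z"
  define f where "f s t = exp (- k * of_real \<bar>x - s\<bar>) * (exp (- k * of_real \<bar>y - t\<bar>) * q (s, t))"
    for s t
  have f_kernel: "exp (- k * of_real (norm1 ((x, y) - r'))) * q r' = (case r' of (s, t) \<Rightarrow> f s t)"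
    for r'
    by (cases r') (simp add: f_def norm1_def distrib_left exp_diff exp_minus field_simps)
  have cont: "continuous_on (cbox (- a, - b) (a, b)) (\<lambda>(s, t). f s t)"
    unfolding f_kernel[symmetric]
    by (intro continuous_intros continuous_on_kernel q)
  have "K_op a b \<tau>0 dS chat \<xi> z q (x, y)
      = c_fun \<tau>0 dS chat z * integral (Omega_bar a b) (\<lambda>(s, t). f s t)"
    unfolding K_op_def k_def[symmetric] f_kernel set_integral_box_continuous(2)[OF cont] ..
  also have "integral (Omega_bar a b) (\<lambda>(s, t). f s t)
      = integral {- a..a} (\<lambda>s. integral {- b..b} (f s))"
    using integral_prod_continuous[OF cont] by simp
  finally have K: "K_op a b \<tau>0 dS chat \<xi> z q (x, y)
      = c_fun \<tau>0 dS chat z * integral {- a..a} (\<lambda>s. integral {- b..b} (f s))" .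
  then show ?A
    unfolding exp_conv_def k_def[symmetric] f_def by simp
  have "integral {- a..a} (\<lambda>s. integral {- b..b} (f s))
      = integral {- b..b} (\<lambda>t. integral {- a..a} (\<lambda>s. f s t))"
    using integral_swap_continuous[OF cont] by simp
  also have "\<dots> = exp_conv k b (\<lambda>t. exp_conv k a (\<lambda>s. q (s, t)) x) y"
    unfolding exp_conv_def f_def Henstock_Kurzweil_Integration.integral_mult_right[symmetric]
    by (simp only: mult.left_commute)
  finally show ?B using K by (simp add: k_def)
qed

text \<open>Each of the two factors of $L(z)$ undoes one of the two convolutions that make up $K(z)$
  and contributes a factor $2k$, whence $L(z)K(z)=4c(z)k^2(z)$ on continuous functions.\<close>
lemma L_op_K_op:
  assumes "a > 0" "b > 0" and q: "continuous_on (Omega_bar a b) q" and r: "r \<in> Omega_bar a b"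
  shows "L_op a b \<xi> z (K_op a b \<tau>0 dS chat \<xi> z q) r
    = 4 * c_fun \<tau>0 dS chat z * (k_fun \<xi> z)\<^sup>2 * q r"
proof -
  define k where "k = k_fun \<xi> z"
  define c where "c = c_fun \<tau>0 dS chat z"
  define w where "w r = k\<^sup>2 * K_op a b \<tau>0 dS chat \<xi> z q r - d2y b (K_op a b \<tau>0 dS chat \<xi> z q) r" for r
  obtain x y where xy: "r = (x, y)" "x \<in> {- a..a}" "y \<in> {- b..b}"
    using r by (cases r) (auto simp: cbox_Pair_eq)
  have w: "w (s, y) = 2 * k * c * exp_conv k a (\<lambda>s. q (s, y)) s" for s
  proof -
    have "d2y b (K_op a b \<tau>0 dS chat \<xi> z q) (s, y)
      = k\<^sup>2 * K_op a b \<tau>0 dS chat \<xi> z q (s, y) - 2 * k * c * exp_conv k a (\<lambda>s. q (s, y)) s"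
      unfolding d2y_def prod.case
      by (rule iterated_vector_derivative_exp_conv[OF \<open>b > 0\<close>
            continuous_on_exp_conv_section(1)[OF q] xy(3)])
         (simp add: K_op_iterated(2)[OF q] k_def c_def)
    then show ?thesis by (simp add: w_def)
  qed
  have "d2x a w (x, y) = k\<^sup>2 * w (x, y) - 2 * k * (2 * k * c) * q (x, y)"
    unfolding d2x_def prod.case
    by (rule iterated_vector_derivative_exp_conv[OF \<open>a > 0\<close>
          continuous_on_section[OF q xy(3)] xy(2) w])
  moreover have "L_op a b \<xi> z (K_op a b \<tau>0 dS chat \<xi> z q) r = k\<^sup>2 * w r - d2x a w r"
    unfolding L_op_def Let_def k_def[symmetric] w_def[abs_def] ..
  ultimately show ?thesis
    unfolding xy k_def[symmetric] c_def[symmetric] by algebra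
qed

text \<open>Smoothing by $K(z)$ is what keeps $K(z)$ from being onto $Y$, and hence
  $z=-\alpha$ out of the resolvent set.\<close>
lemma K_op_differentiable_fst:
  assumes q: "continuous_on (Omega_bar a b) q" and x: "x \<in> {- a<..<a}"
  shows "(\<lambda>s. K_op a b \<tau>0 dS chat \<xi> z q (s, y)) differentiable (at x)"
proof -
  obtain v where "\<And>x. x \<in> {- a..a} \<Longrightarrow>
      (exp_conv (k_fun \<xi> z) a (\<lambda>s. exp_conv (k_fun \<xi> z) b (\<lambda>t. q (s, t)) y)
        has_vector_derivative v x) (at x within {- a..a})"
    using exp_conv_second_derivative[OF continuous_on_exp_conv_section(2)[OF q]] by metis
  then have "((\<lambda>s. K_op a b \<tau>0 dS chat \<xi> z q (s, y)) has_vector_derivative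
      c_fun \<tau>0 dS chat z * v x) (at x within {- a..a})"
    using x unfolding K_op_iterated(1)[OF q] by (intro has_vector_derivative_mult_right) auto
  then show ?thesis
    using x by (auto simp: at_within_Icc_at intro: differentiableI_vector)
qed

section \<open>Norms and derivatives in the history space\<close>

lemma Y_norm_cong:
  assumes "\<And>r. r \<in> Omega_bar a b \<Longrightarrow> f r = h r"
  shows "Y_norm a b f = Y_norm a b h"
  unfolding Y_norm_def using assms by (intro SUP_cong) auto

lemma norm_le_Y_norm:
  assumes "continuous_on (Omega_bar a b) q" "r \<in> Omega_bar a b"
  shows "norm (q r) \<le> Y_norm a b q"
proof -
  have "compact ((\<lambda>r. norm (q r)) ` Omega_bar a b)"
    by (intro compact_continuous_image continuous_on_norm assms compact_cbox)
  then have "bdd_above ((\<lambda>r. norm (q r)) ` Omega_bar a b)"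
    by (intro bounded_imp_bdd_above compact_imp_bounded)
  then show ?thesis unfolding Y_norm_def by (intro cSUP_upper assms)
qed

lemma Y_norm_tendsto_0_mult:
  assumes q: "continuous_on (Omega_bar a b) q" and ab: "a > 0" "b > 0" and w: "(w \<longlongrightarrow> 0) F"
  shows "((\<lambda>s. Y_norm a b (\<lambda>r. w s * q r)) \<longlongrightarrow> 0) F"
proof (rule tendsto_sandwich[OF _ _ tendsto_const])
  have 0: "(0, 0) \<in> Omega_bar a b" using ab by (simp add: cbox_Pair_eq)
  have "0 \<le> Y_norm a b (\<lambda>r. w s * q r)" for s
    by (rule order_trans[OF norm_ge_zero norm_le_Y_norm[OF _ 0]]) (intro continuous_intros q)
  then show "\<forall>\<^sub>F s in F. 0 \<le> Y_norm a b (\<lambda>r. w s * q r)" by simp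
  have "Y_norm a b (\<lambda>r. w s * q r) \<le> norm (w s) * Y_norm a b q" for s
    unfolding Y_norm_def[of a b "\<lambda>r. w s * q r"]
  proof (rule cSUP_least)
    show "Omega_bar a b \<noteq> {}" using 0 by blast
  qed (auto simp: norm_mult intro!: mult_left_mono norm_le_Y_norm[OF q])
  then show "\<forall>\<^sub>F s in F. Y_norm a b (\<lambda>r. w s * q r) \<le> norm (w s) * Y_norm a b q" by simp
  show "((\<lambda>s. norm (w s) * Y_norm a b q) \<longlongrightarrow> 0) F"
    by (rule tendsto_mult_left_zero[OF tendsto_norm_zero[OF w]])
qed

lemma has_vector_derivative_iff_quotient:
  fixes w :: "real \<Rightarrow> complex"
  shows "(w has_vector_derivative D) (at \<theta> within I) \<longleftrightarrow>
     ((\<lambda>s. (w s - w \<theta>) / of_real (s - \<theta>) - D) \<longlongrightarrow> 0) (at \<theta> within I)"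
proof -
  have "norm ((w s - w \<theta>) - (s - \<theta>) *\<^sub>R D) / norm (s - \<theta>) =
      norm ((w s - w \<theta>) / of_real (s - \<theta>) - D)" if "s \<noteq> \<theta>" for s
  proof -
    have "(w s - w \<theta>) / of_real (s - \<theta>) - D
        = ((w s - w \<theta>) - (s - \<theta>) *\<^sub>R D) / of_real (s - \<theta>)"
      using that by (simp add: diff_divide_distrib scaleR_conv_of_real flip: of_real_diff)
    then show ?thesis by (simp only: norm_divide norm_of_real real_norm_def)
  qed
  then have "((\<lambda>s. norm ((w s - w \<theta>) - (s - \<theta>) *\<^sub>R D) / norm (s - \<theta>)) \<longlongrightarrow> 0) (at \<theta> within I) \<longleftrightarrow>
      ((\<lambda>s. norm ((w s - w \<theta>) / of_real (s - \<theta>) - D)) \<longlongrightarrow> 0) (at \<theta> within I)"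
    by (intro tendsto_cong) (auto simp: eventually_at_filter)
  then show ?thesis
    by (simp add: has_vector_derivative_def has_derivative_iff_norm bounded_linear_scaleR_left
        tendsto_norm_zero_iff)
qed

lemma X_space_eq_iff:
  assumes "\<phi> \<in> X_space a b \<tau>" "\<omega> \<in> X_space a b \<tau>"
  shows "\<phi> = \<omega> \<longleftrightarrow> (\<forall>\<theta>\<in>{- \<tau>..0}. \<forall>r\<in>Omega_bar a b. \<phi> \<theta> r = \<omega> \<theta> r)"
proof
  assume eq: "\<forall>\<theta>\<in>{- \<tau>..0}. \<forall>r\<in>Omega_bar a b. \<phi> \<theta> r = \<omega> \<theta> r"
  show "\<phi> = \<omega>"
  proof (rule PiE_ext)
    show "\<phi> \<in> {- \<tau>..0} \<rightarrow>\<^sub>E Y_space a b" "\<omega> \<in> {- \<tau>..0} \<rightarrow>\<^sub>E Y_space a b"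
      using assms by (auto simp: X_space_def)
    fix \<theta> assume \<theta>: "\<theta> \<in> {- \<tau>..0}"
    show "\<phi> \<theta> = \<omega> \<theta>"
      using assms \<theta> eq
      by (intro extensionalityI[of _ "Omega_bar a b"]) (auto simp: X_space_def Y_space_def PiE_iff)
  qed
qed simp

text \<open>Convergence in the norm of $Y$ implies convergence at every point, so that the abstract
  equation $(z-A)\varphi=f$ becomes, at each \<open>r\<close>, a scalar linear differential equation in
  $\theta$.\<close>
lemma X_derivative_pointwise:
  assumes "\<phi> \<in> X_space a b \<tau>" "\<phi>' \<in> X_space a b \<tau>" and d: "has_X_derivative a b \<tau> \<phi> \<phi>'"
    and \<theta>: "\<theta> \<in> {- \<tau>..0}" and r: "r \<in> Omega_bar a b"
  shows "((\<lambda>s. \<phi> s r) has_vector_derivative \<phi>' \<theta> r) (at \<theta> within {- \<tau>..0})"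
  unfolding has_vector_derivative_iff_quotient
proof (rule Lim_null_comparison)
  have cont: "continuous_on (Omega_bar a b) (\<phi> s)" "continuous_on (Omega_bar a b) (\<phi>' s)"
    if "s \<in> {- \<tau>..0}" for s
    using assms(1,2) that by (auto simp: X_space_def Y_space_def PiE_iff)
  show "((\<lambda>s. Y_norm a b (\<lambda>r. (\<phi> s r - \<phi> \<theta> r) / of_real (s - \<theta>) - \<phi>' \<theta> r)) \<longlongrightarrow> 0)
      (at \<theta> within {- \<tau>..0})"
    using d \<theta> by (auto simp: has_X_derivative_def)
  show "\<forall>\<^sub>F s in at \<theta> within {- \<tau>..0}. norm ((\<phi> s r - \<phi> \<theta> r) / of_real (s - \<theta>) - \<phi>' \<theta> r)
      \<le> Y_norm a b (\<lambda>r. (\<phi> s r - \<phi> \<theta> r) / of_real (s - \<theta>) - \<phi>' \<theta> r)"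
    unfolding eventually_at_filter
  proof (intro always_eventually allI impI)
    fix s assume "s \<noteq> \<theta>" "s \<in> {- \<tau>..0}"
    then show "norm ((\<phi> s r - \<phi> \<theta> r) / of_real (s - \<theta>) - \<phi>' \<theta> r)
      \<le> Y_norm a b (\<lambda>r. (\<phi> s r - \<phi> \<theta> r) / of_real (s - \<theta>) - \<phi>' \<theta> r)"
      by (intro norm_le_Y_norm[OF _ r] continuous_intros cont \<theta>) auto
  qed
qed

text \<open>The description operator in \<^const>\<open>A_op\<close> is justified by uniqueness of pointwise
  derivatives on a nondegenerate interval.\<close>
lemma A_op_eq:
  assumes \<tau>: "tau_max a b \<tau>0 > 0"
    and \<phi>: "\<phi> \<in> X_space a b (tau_max a b \<tau>0)" "\<phi>' \<in> X_space a b (tau_max a b \<tau>0)"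
      "has_X_derivative a b (tau_max a b \<tau>0) \<phi> \<phi>'"
  shows "A_op a b \<tau>0 \<phi> = \<phi>'"
  unfolding A_op_def
proof (rule the_equality, use \<phi> in blast, elim conjE)
  fix \<omega> assume \<omega>: "\<omega> \<in> X_space a b (tau_max a b \<tau>0)" "has_X_derivative a b (tau_max a b \<tau>0) \<phi> \<omega>"
  show "\<omega> = \<phi>'"
    unfolding X_space_eq_iff[OF \<omega>(1) \<phi>(2)]
  proof (intro ballI)
    fix \<theta> r assume "\<theta> \<in> {- tau_max a b \<tau>0..0}" "r \<in> Omega_bar a b"
    then show "\<omega> \<theta> r = \<phi>' \<theta> r"
      using vector_derivative_unique_within_closed_interval[of "- tau_max a b \<tau>0" 0 \<theta>]
        X_derivative_pointwise[OF \<phi>(1) \<omega>] X_derivative_pointwise[OF \<phi>] \<tau>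
      unfolding cbox_interval by (metis neg_less_0_iff_less)
  qed
qed

text \<open>Products of a scalar function of time with a fixed element of $Y$, cut off to the
  domains on which elements of $X$ are extensional.  All histories constructed below are of this
  form.\<close>
definition separated ::
  "real \<Rightarrow> real \<Rightarrow> real \<Rightarrow> (real \<Rightarrow> complex) \<Rightarrow> (real \<times> real \<Rightarrow> complex)
    \<Rightarrow> (real \<Rightarrow> real \<times> real \<Rightarrow> complex)" where
  "separated a b \<tau> w q = (\<lambda>\<theta>\<in>{- \<tau>..0}. \<lambda>r\<in>Omega_bar a b. w \<theta> * q r)"

lemma separated_in_X_space:
  assumes w: "continuous_on {- \<tau>..0} w" and q: "q \<in> Y_space a b" and ab: "a > 0" "b > 0"
  shows "separated a b \<tau> w q \<in> X_space a b \<tau>"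
proof -
  have qc: "continuous_on (Omega_bar a b) q" using q by (simp add: Y_space_def)
  have "(\<lambda>r\<in>Omega_bar a b. w \<theta> * q r) \<in> Y_space a b" for \<theta>
    unfolding Y_space_def
    by (auto intro!: continuous_on_mult_left qc cong: continuous_on_cong)
  moreover have "((\<lambda>s. Y_norm a b (\<lambda>r. separated a b \<tau> w q s r - separated a b \<tau> w q \<theta> r)) \<longlongrightarrow> 0)
      (at \<theta> within {- \<tau>..0})" if \<theta>: "\<theta> \<in> {- \<tau>..0}" for \<theta>
  proof (rule Lim_transform_eventually)
    have "((\<lambda>s. w s - w \<theta>) \<longlongrightarrow> 0) (at \<theta> within {- \<tau>..0})"
      using w \<theta> by (auto simp: continuous_on_def LIM_zero_iff)
    then show "((\<lambda>s. Y_norm a b (\<lambda>r. (w s - w \<theta>) * q r)) \<longlongrightarrow> 0) (at \<theta> within {- \<tau>..0})"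
      by (rule Y_norm_tendsto_0_mult[OF qc ab])
    show "\<forall>\<^sub>F s in at \<theta> within {- \<tau>..0}. Y_norm a b (\<lambda>r. (w s - w \<theta>) * q r) =
        Y_norm a b (\<lambda>r. separated a b \<tau> w q s r - separated a b \<tau> w q \<theta> r)"
      unfolding eventually_at_filter using \<theta>
      by (auto intro!: always_eventually Y_norm_cong simp: separated_def left_diff_distrib)
  qed
  ultimately show ?thesis by (auto simp: X_space_def separated_def)
qed

lemma separated_has_X_derivative:
  assumes w: "\<And>\<theta>. \<theta> \<in> {- \<tau>..0} \<Longrightarrow> (w has_vector_derivative w' \<theta>) (at \<theta> within {- \<tau>..0})"
    and q: "q \<in> Y_space a b" and ab: "a > 0" "b > 0"
  shows "has_X_derivative a b \<tau> (separated a b \<tau> w q) (separated a b \<tau> w' q)"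
  unfolding has_X_derivative_def
proof
  fix \<theta> assume \<theta>: "\<theta> \<in> {- \<tau>..0}"
  have qc: "continuous_on (Omega_bar a b) q" using q by (simp add: Y_space_def)
  show "((\<lambda>s. Y_norm a b (\<lambda>r. (separated a b \<tau> w q s r - separated a b \<tau> w q \<theta> r) / of_real (s - \<theta>)
      - separated a b \<tau> w' q \<theta> r)) \<longlongrightarrow> 0) (at \<theta> within {- \<tau>..0})"
  proof (rule Lim_transform_eventually)
    show "((\<lambda>s. Y_norm a b (\<lambda>r. ((w s - w \<theta>) / of_real (s - \<theta>) - w' \<theta>) * q r)) \<longlongrightarrow> 0)
        (at \<theta> within {- \<tau>..0})"
      using w[OF \<theta>] unfolding has_vector_derivative_iff_quotient
      by (rule Y_norm_tendsto_0_mult[OF qc ab])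
    show "\<forall>\<^sub>F s in at \<theta> within {- \<tau>..0}.
        Y_norm a b (\<lambda>r. ((w s - w \<theta>) / of_real (s - \<theta>) - w' \<theta>) * q r) =
        Y_norm a b (\<lambda>r. (separated a b \<tau> w q s r - separated a b \<tau> w q \<theta> r) / of_real (s - \<theta>)
          - separated a b \<tau> w' q \<theta> r)"
      unfolding eventually_at_filter using \<theta>
      by (auto intro!: always_eventually Y_norm_cong simp: separated_def algebra_simps diff_divide_distrib)
  qed
qed

lemma norm1_bounds:
  assumes "r \<in> Omega_bar a b" "r' \<in> Omega_bar a b"
  shows "0 \<le> norm1 (r - r')" "norm1 (r - r') \<le> 2 * a + 2 * b"
  using assms by (cases r; cases r'; auto simp: norm1_def cbox_Pair_eq)+

text \<open>The operator $DG(0)$ looks only at times at most $-\tau_0$.  On a history that is a pure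
  exponential there, the factor $e^{z\theta}$ at $\theta=-\tau_0-\|r-r'\|_1$ merges with the kernel
  $J$ into the kernel of $K(z)$.\<close>
lemma DG0_exp:
  assumes r: "r \<in> Omega_bar a b"
    and \<phi>: "\<And>\<theta> r'. \<theta> \<in> {- tau_max a b \<tau>0..- \<tau>0} \<Longrightarrow> r' \<in> Omega_bar a b \<Longrightarrow>
      \<phi> \<theta> r' = exp (z * of_real \<theta>) * q r'"
  shows "DG0 a b \<tau>0 dS chat \<xi> \<phi> r = K_op a b \<tau>0 dS chat \<xi> z q r"
proof -
  have "(LINT r':Omega a b|lborel. J chat \<xi> r r' * \<phi> (- \<tau>0 - norm1 (r - r')) r')
      = (LINT r':Omega a b|lborel. chat * exp (- of_real \<tau>0 * z) *
          (exp (- k_fun \<xi> z * of_real (norm1 (r - r'))) * q r'))"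
  proof (rule set_lebesgue_integral_cong, simp, intro allI impI)
    fix r' assume "r' \<in> Omega a b"
    then have r': "r' \<in> Omega_bar a b" by (rule Omega_imp_Omega_bar)
    have "\<phi> (- \<tau>0 - norm1 (r - r')) r' = exp (z * of_real (- \<tau>0 - norm1 (r - r'))) * q r'"
      using norm1_bounds[OF r r'] by (intro \<phi> r') (auto simp: tau_max_def)
    moreover have "exp (- \<xi> * of_real (norm1 (r - r'))) * exp (z * of_real (- \<tau>0 - norm1 (r - r')))
        = exp (- of_real \<tau>0 * z) * exp (- k_fun \<xi> z * of_real (norm1 (r - r')))"
      unfolding exp_add[symmetric] k_fun_def by (simp add: algebra_simps)
    ultimately show "J chat \<xi> r r' * \<phi> (- \<tau>0 - norm1 (r - r')) r' =
        chat * exp (- of_real \<tau>0 * z) * (exp (- k_fun \<xi> z * of_real (norm1 (r - r'))) * q r')"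
      unfolding J_def by simp
  qed
  then show ?thesis
    unfolding DG0_def K_op_def c_fun_def by simp
qed

section \<open>Boundedness and linearity of the integral operator\<close>

lemma norm_kernel_le:
  fixes k :: complex
  assumes "r \<in> Omega_bar a b" "r' \<in> Omega_bar a b"
  shows "norm (exp (- k * of_real (norm1 (r - r')))) \<le> exp (norm k * (2 * a + 2 * b))"
proof -
  have "norm (exp (- k * of_real (norm1 (r - r')))) \<le> exp (norm (- k * of_real (norm1 (r - r'))))"
    by (rule norm_exp)
  also have "\<dots> \<le> exp (norm k * (2 * a + 2 * b))"
    using norm1_bounds[OF assms] by (simp add: norm_mult mult_left_mono)
  finally show ?thesis .
qed

lemma set_integrable_kernel_mult:
  fixes f :: "real \<times> real \<Rightarrow> complex"
  assumes f: "set_integrable lborel (Omega a b) f" and r: "r \<in> Omega_bar a b"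
  shows "set_integrable lborel (Omega a b) (\<lambda>r'. exp (- k * of_real (norm1 (r - r'))) * f r')"
proof (rule set_integrable_bound)
  define M where "M = exp (norm k * (2 * a + 2 * b))"
  show "set_integrable lborel (Omega a b) (\<lambda>r'. of_real M * f r')"
    using f by simp
  have [measurable]: "(\<lambda>r'. exp (- k * of_real (norm1 (r - r')))) \<in> borel_measurable lborel"
    using borel_measurable_continuous_onI[OF continuous_on_kernel] by simp
  have [measurable]: "(\<lambda>r'. indicator (Omega a b) r' *\<^sub>R f r') \<in> borel_measurable lborel"
    using f unfolding set_integrable_def by (rule borel_measurable_integrable)
  have "(\<lambda>r'. exp (- k * of_real (norm1 (r - r'))) * (indicator (Omega a b) r' *\<^sub>R f r'))
      \<in> borel_measurable lborel"
    by measurable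
  then show "set_borel_measurable lborel (Omega a b) (\<lambda>r'. exp (- k * of_real (norm1 (r - r'))) * f r')"
    by (simp add: set_borel_measurable_def)
  show "AE r' in lborel. r' \<in> Omega a b \<longrightarrow>
      norm (exp (- k * of_real (norm1 (r - r'))) * f r') \<le> norm (of_real M * f r')"
  proof (intro always_eventually allI impI)
    fix r' assume "r' \<in> Omega a b"
    then have "r' \<in> Omega_bar a b" by (rule Omega_imp_Omega_bar)
    from norm_kernel_le[OF r this, of k]
    show "norm (exp (- k * of_real (norm1 (r - r'))) * f r') \<le> norm (of_real M * f r')"
      unfolding norm_mult M_def by (intro mult_right_mono) auto
  qed
qed

lemma K_op_cong:
  assumes "\<And>r'. r' \<in> Omega a b \<Longrightarrow> f r' = h r'"
  shows "K_op a b \<tau>0 dS chat \<xi> z f r = K_op a b \<tau>0 dS chat \<xi> z h r"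
  unfolding K_op_def using assms
  by (intro arg_cong2[where f = "(*)"] refl set_lebesgue_integral_cong) auto

lemma K_op_mult:
  "K_op a b \<tau>0 dS chat \<xi> z (\<lambda>r'. d * f r') r = d * K_op a b \<tau>0 dS chat \<xi> z f r"
  unfolding K_op_def mult.left_commute[of _ d] set_integral_mult_right ..

lemma K_op_diff:
  assumes "set_integrable lborel (Omega a b) f" "set_integrable lborel (Omega a b) h"
    and "r \<in> Omega_bar a b"
  shows "K_op a b \<tau>0 dS chat \<xi> z (\<lambda>r'. f r' - h r') r
    = K_op a b \<tau>0 dS chat \<xi> z f r - K_op a b \<tau>0 dS chat \<xi> z h r"
  unfolding K_op_def right_diff_distrib
    set_integral_diff(2)[OF set_integrable_kernel_mult[OF assms(1,3)]
      set_integrable_kernel_mult[OF assms(2,3)]] ..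

lemma K_op_sum:
  assumes f: "\<And>i. set_integrable lborel (Omega a b) (f i)" and r: "r \<in> Omega_bar a b"
  shows "K_op a b \<tau>0 dS chat \<xi> z (\<lambda>r'. \<Sum>i\<in>N. f i r') r
    = (\<Sum>i\<in>N. K_op a b \<tau>0 dS chat \<xi> z (f i) r)"
  unfolding K_op_def set_lebesgue_integral_def sum_distrib_left scaleR_sum_right
    Bochner_Integration.integral_sum[OF set_integrable_kernel_mult[OF f r, unfolded set_integrable_def]] ..

lemma Delta_op_diff:
  assumes "continuous_on (Omega_bar a b) f" "continuous_on (Omega_bar a b) h" "r \<in> Omega_bar a b"
  shows "Delta_op a b \<alpha> \<tau>0 dS chat \<xi> z (\<lambda>r\<in>Omega_bar a b. f r - h r) r
    = Delta_op a b \<alpha> \<tau>0 dS chat \<xi> z f r - Delta_op a b \<alpha> \<tau>0 dS chat \<xi> z h r"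
proof -
  have "K_op a b \<tau>0 dS chat \<xi> z (\<lambda>r\<in>Omega_bar a b. f r - h r) r
      = K_op a b \<tau>0 dS chat \<xi> z (\<lambda>r. f r - h r) r"
    by (intro K_op_cong) (simp add: Omega_imp_Omega_bar)
  also have "\<dots> = K_op a b \<tau>0 dS chat \<xi> z f r - K_op a b \<tau>0 dS chat \<xi> z h r"
    using assms by (intro K_op_diff set_integral_box_continuous)
  finally show ?thesis using assms(3) by (simp add: Delta_op_def algebra_simps)
qed

section \<open>The characteristic operator on the resolvent set\<close>

text \<open>A function in the kernel of $\Delta(z)$ yields the eigenfunction
  $\theta\mapsto e^{z\theta}q$ of \<open>A\<close>: the equation $\Delta(z)q=0$ is exactly the boundary
  condition in the domain of \<open>A\<close>.\<close>
lemma exp_separated_in_A_dom: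
  assumes ab: "a > 0" "b > 0" and \<tau>0: "\<tau>0 > 0" and q: "q \<in> Y_space a b"
    and \<Delta>: "\<forall>r\<in>Omega_bar a b. Delta_op a b \<alpha> \<tau>0 dS chat \<xi> z q r = 0"
  defines "\<tau> \<equiv> tau_max a b \<tau>0"
  defines "\<phi> \<equiv> separated a b \<tau> (\<lambda>\<theta>. exp (z * of_real \<theta>)) q"
  shows "\<phi> \<in> A_dom a b \<alpha> \<tau>0 dS chat \<xi>"
    and "zI_minus_A a b \<tau>0 z \<phi> = (\<lambda>\<theta>\<in>{- \<tau>..0}. \<lambda>r\<in>Omega_bar a b. 0)"
proof -
  define \<phi>' where "\<phi>' = separated a b \<tau> (\<lambda>\<theta>. z * exp (z * of_real \<theta>)) q"
  have \<tau>: "\<tau> > 0" using ab \<tau>0 by (simp add: \<tau>_def tau_max_def)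
  have X: "\<phi> \<in> X_space a b \<tau>" "\<phi>' \<in> X_space a b \<tau>"
    unfolding \<phi>_def \<phi>'_def by (intro separated_in_X_space continuous_intros q ab)+
  have d: "has_X_derivative a b \<tau> \<phi> \<phi>'"
    unfolding \<phi>_def \<phi>'_def
    by (intro separated_has_X_derivative has_vector_derivative_exp q ab)
  have A: "A_op a b \<tau>0 \<phi> = \<phi>'"
    using A_op_eq[of a b \<tau>0 \<phi> \<phi>'] X d \<tau> unfolding \<tau>_def by simp
  show "zI_minus_A a b \<tau>0 z \<phi> = (\<lambda>\<theta>\<in>{- \<tau>..0}. \<lambda>r\<in>Omega_bar a b. 0)"
    unfolding zI_minus_A_def A \<tau>_def[symmetric]
    by (intro restrict_ext) (simp add: \<phi>_def \<phi>'_def separated_def)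
  have "\<phi>' 0 r = - of_real \<alpha> * \<phi> 0 r + DG0 a b \<tau>0 dS chat \<xi> \<phi> r" if r: "r \<in> Omega_bar a b" for r
  proof -
    have "DG0 a b \<tau>0 dS chat \<xi> \<phi> r = K_op a b \<tau>0 dS chat \<xi> z q r"
      using \<tau>0 by (intro DG0_exp[OF r]) (simp add: \<phi>_def separated_def \<tau>_def)
    then show ?thesis
      using \<Delta> r \<tau> by (simp add: \<phi>_def \<phi>'_def separated_def Delta_op_def algebra_simps)
  qed
  then show "\<phi> \<in> A_dom a b \<alpha> \<tau>0 dS chat \<xi>"
    using X d by (auto simp: A_dom_def \<tau>_def)
qed

lemma Delta_injective_on_resolvent_set:
  assumes ab: "a > 0" "b > 0" and \<tau>0: "\<tau>0 > 0"
    and z: "z \<in> A_resolvent_set a b \<alpha> \<tau>0 dS chat \<xi>" and q: "q \<in> Y_space a b"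
    and \<Delta>: "\<forall>r\<in>Omega_bar a b. Delta_op a b \<alpha> \<tau>0 dS chat \<xi> z q r = 0"
    and r: "r \<in> Omega_bar a b"
  shows "q r = 0"
proof -
  \<comment> \<open>Injectivity compares two histories in the domain; the second one comes from \<open>?q0\<close>.\<close>
  let ?\<phi> = "separated a b (tau_max a b \<tau>0) (\<lambda>\<theta>. exp (z * of_real \<theta>))"
  let ?q0 = "\<lambda>r\<in>Omega_bar a b. 0"
  have q0: "?q0 \<in> Y_space a b"
    by (auto simp: Y_space_def cong: continuous_on_cong)
  have \<Delta>0: "\<forall>r\<in>Omega_bar a b. Delta_op a b \<alpha> \<tau>0 dS chat \<xi> z ?q0 r = 0"
  proof
    fix r assume r: "r \<in> Omega_bar a b"
    have "K_op a b \<tau>0 dS chat \<xi> z ?q0 r = K_op a b \<tau>0 dS chat \<xi> z (\<lambda>_. 0) r"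
      by (intro K_op_cong) (simp add: Omega_imp_Omega_bar)
    also have "\<dots> = 0" by (simp add: K_op_def set_lebesgue_integral_def)
    finally show "Delta_op a b \<alpha> \<tau>0 dS chat \<xi> z ?q0 r = 0"
      using r by (simp add: Delta_op_def)
  qed
  note * = exp_separated_in_A_dom[OF ab \<tau>0]
  have "inj_on (zI_minus_A a b \<tau>0 z) (A_dom a b \<alpha> \<tau>0 dS chat \<xi>)"
    using z by (auto simp: A_resolvent_set_def bij_betw_def)
  moreover have "zI_minus_A a b \<tau>0 z (?\<phi> q) = zI_minus_A a b \<tau>0 z (?\<phi> ?q0)"
    unfolding *(2)[OF q \<Delta>] *(2)[OF q0 \<Delta>0] ..
  ultimately have "?\<phi> q = ?\<phi> ?q0"
    using *(1)[OF q \<Delta>] *(1)[OF q0 \<Delta>0] by (rule inj_onD)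
  from fun_cong[OF fun_cong[OF this, of 0], of r] show "q r = 0"
    using r ab \<tau>0 by (simp add: separated_def tau_max_def)
qed

lemma has_real_derivative_max_0_power2:
  "((\<lambda>t. (max 0 t)\<^sup>2) has_real_derivative 2 * max 0 t) (at t within S)" for t :: real
proof -
  consider "t < 0" | "t > 0" | "t = 0" by linarith
  then have "((\<lambda>t. (max 0 t)\<^sup>2) has_real_derivative 2 * max 0 t) (at t)"
  proof cases
    case 1
    have "((\<lambda>_. 0) has_real_derivative 2 * max 0 t) (at t)"
      using 1 by (auto intro!: derivative_eq_intros)
    then show ?thesis
      by (rule DERIV_cong_ev[THEN iffD1, rotated -1])
         (use 1 in \<open>auto intro!: eventually_mono[OF eventually_nhds_in_open[of "{..<0}"]]\<close>)
  next
    case 2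
    have "((\<lambda>t. t\<^sup>2) has_real_derivative 2 * max 0 t) (at t)"
      using 2 by (auto intro!: derivative_eq_intros)
    then show ?thesis
      by (rule DERIV_cong_ev[THEN iffD1, rotated -1])
         (use 2 in \<open>auto intro!: eventually_mono[OF eventually_nhds_in_open[of "{0<..}"]]\<close>)
  next
    case 3
    have "((\<lambda>s::real. max 0 s) \<longlongrightarrow> 0) (at 0)"
      using tendsto_max[OF tendsto_const tendsto_ident_at, of 0 "0::real" UNIV] by simp
    then have "((\<lambda>s::real. ((max 0 s)\<^sup>2 - (max 0 0)\<^sup>2) / (s - 0)) \<longlongrightarrow> 0) (at 0)"
      by (rule Lim_transform_eventually)
         (auto simp: eventually_at_filter max_def power2_eq_square)
    with 3 show ?thesis by (simp add: has_field_derivative_iff)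
  qed
  then show ?thesis by (rule has_field_derivative_at_within)
qed

text \<open>A continuously differentiable function that vanishes at all times at most $-\tau_0$
  but has slope one at time zero; it lets an inhomogeneity act on the boundary condition
  without being seen by $DG(0)$.  The witness is $\theta(\theta+\tau_0)^2/\tau_0^2$ on
  $[-\tau_0,\infty)$, whose double zero at $-\tau_0$ makes it $C^1$.\<close>
lemma delay_cutoff:
  assumes "\<tau>0 > 0"
  shows "\<exists>G G' :: real \<Rightarrow> real. G 0 = 0 \<and> G' 0 = 1 \<and> (\<forall>\<theta>\<le>- \<tau>0. G \<theta> = 0) \<and>
    (\<forall>\<theta> S. (G has_real_derivative G' \<theta>) (at \<theta> within S)) \<and> continuous_on UNIV G'"
proof -
  let ?m = "\<lambda>\<theta>. max 0 (\<theta> + \<tau>0)"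
  define G where "G \<theta> = \<theta> * (?m \<theta>)\<^sup>2 / \<tau>0\<^sup>2" for \<theta>
  define G' where "G' \<theta> = ((?m \<theta>)\<^sup>2 + \<theta> * (2 * ?m \<theta>)) / \<tau>0\<^sup>2" for \<theta>
  show ?thesis
  proof (rule exI[of _ G], rule exI[of _ G'], intro conjI allI impI)
    show "G 0 = 0" "G' 0 = 1"
      using assms by (auto simp: G_def G'_def)
    show "G \<theta> = 0" if "\<theta> \<le> - \<tau>0" for \<theta>
      using assms that by (auto simp: G_def G'_def)
    show "continuous_on UNIV G'"
      unfolding G'_def using assms by (intro continuous_intros) auto
    fix \<theta> S
    have "((\<lambda>\<theta>. (?m \<theta>)\<^sup>2) has_real_derivative 2 * ?m \<theta> * 1) (at \<theta> within S)"
      by (rule DERIV_chain'[where g = "\<lambda>t. (max 0 t)\<^sup>2"])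
         (auto intro!: derivative_eq_intros has_real_derivative_max_0_power2)
    from DERIV_cdivide[OF DERIV_mult[OF DERIV_ident this], of "\<tau>0\<^sup>2"]
    show "(G has_real_derivative G' \<theta>) (at \<theta> within S)"
      unfolding G_def G'_def by (simp add: ac_simps)
  qed
qed

text \<open>Solve $(z-A)\varphi=f$ with $f(\theta)=e^{z\theta}G'(\theta)g$, where \<open>G\<close> is the cutoff
  of the previous lemma.  The differential equation gives
  $\varphi(\theta)=e^{z\theta}(\varphi(0)-G(\theta)g)$, so that $\varphi$ is a pure exponential at
  all times at most $-\tau_0$ and $DG(0)\varphi=K(z)\varphi(0)$.  As $f(0)=g$, the boundary
  condition reads $\Delta(z)\varphi(0)=g$.\<close>
lemma Delta_surjective_on_resolvent_set:
  assumes ab: "a > 0" "b > 0" and \<tau>0: "\<tau>0 > 0"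
    and z: "z \<in> A_resolvent_set a b \<alpha> \<tau>0 dS chat \<xi>" and g: "g \<in> Y_space a b"
  shows "\<exists>q\<in>Y_space a b. \<forall>r\<in>Omega_bar a b. Delta_op a b \<alpha> \<tau>0 dS chat \<xi> z q r = g r"
proof -
  define \<tau> where "\<tau> = tau_max a b \<tau>0"
  have \<tau>: "\<tau> > 0" "\<tau>0 \<le> \<tau>" using ab \<tau>0 by (auto simp: \<tau>_def tau_max_def)
  obtain G G' :: "real \<Rightarrow> real" where G: "G 0 = 0" "G' 0 = 1" "\<And>\<theta>. \<theta> \<le> - \<tau>0 \<Longrightarrow> G \<theta> = 0"
    "\<And>\<theta> S. (G has_real_derivative G' \<theta>) (at \<theta> within S)" "continuous_on UNIV G'"
    using delay_cutoff[OF \<tau>0] by blast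
  define f where "f = separated a b \<tau> (\<lambda>\<theta>. exp (z * of_real \<theta>) * of_real (G' \<theta>)) g"
  have "f \<in> X_space a b \<tau>"
    unfolding f_def
    by (intro separated_in_X_space continuous_intros g ab continuous_on_subset[OF G(5)]) auto
  then have "f \<in> zI_minus_A a b \<tau>0 z ` A_dom a b \<alpha> \<tau>0 dS chat \<xi>"
    using z by (auto simp: A_resolvent_set_def \<tau>_def bij_betw_def)
  then obtain \<phi> where \<phi>: "\<phi> \<in> A_dom a b \<alpha> \<tau>0 dS chat \<xi>" "f = zI_minus_A a b \<tau>0 z \<phi>"
    by (rule imageE)
  then obtain \<phi>' where X: "\<phi> \<in> X_space a b \<tau>" "\<phi>' \<in> X_space a b \<tau>"
    and d: "has_X_derivative a b \<tau> \<phi> \<phi>'"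
    and bc: "\<And>r. r \<in> Omega_bar a b \<Longrightarrow>
      \<phi>' 0 r = - of_real \<alpha> * \<phi> 0 r + DG0 a b \<tau>0 dS chat \<xi> \<phi> r"
    by (auto simp: A_dom_def \<tau>_def)
  have A: "A_op a b \<tau>0 \<phi> = \<phi>'"
    using A_op_eq[of a b \<tau>0 \<phi> \<phi>'] X d \<tau> unfolding \<tau>_def by simp
  have ode: "\<phi>' \<theta> r = z * \<phi> \<theta> r - exp (z * of_real \<theta>) * of_real (G' \<theta>) * g r"
    if "\<theta> \<in> {- \<tau>..0}" "r \<in> Omega_bar a b" for \<theta> r
  proof -
    have "zI_minus_A a b \<tau>0 z \<phi> \<theta> r = f \<theta> r" using \<phi> by simp
    then show ?thesis
      using that unfolding zI_minus_A_def A \<tau>_def[symmetric] f_def separated_def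
      by (simp add: algebra_simps)
  qed
  have tail: "\<phi> \<theta> r = exp (z * of_real \<theta>) * \<phi> 0 r"
    if \<theta>: "\<theta> \<in> {- \<tau>..- \<tau>0}" and r: "r \<in> Omega_bar a b" for \<theta> r
  proof -
    \<comment> \<open>The variation-of-constants expression, constant along solutions.\<close>
    define u where "u \<theta> = exp (- z * of_real \<theta>) * \<phi> \<theta> r + of_real (G \<theta>) * g r" for \<theta>
    have inv: "exp (- z * of_real s) * exp (z * of_real s) = 1" for s
      by (simp add: exp_add[symmetric])
    have "(u has_vector_derivative 0) (at s within {- \<tau>..0})" if s: "s \<in> {- \<tau>..0}" for s
    proof -
      have "(u has_vector_derivative
          exp (- z * of_real s) * \<phi>' s r + - z * exp (- z * of_real s) * \<phi> s r + of_real (G' s) * g r)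
          (at s within {- \<tau>..0})"
        unfolding u_def
        by (intro has_vector_derivative_add has_vector_derivative_mult has_vector_derivative_exp
            has_vector_derivative_mult_left has_vector_derivative_of_real G(4)
            X_derivative_pointwise[OF X d s r])
      moreover have "exp (- z * of_real s) * \<phi>' s r + - z * exp (- z * of_real s) * \<phi> s r
          + of_real (G' s) * g r = (1 - exp (- z * of_real s) * exp (z * of_real s)) * of_real (G' s) * g r"
        unfolding ode[OF s r] by (simp add: algebra_simps)
      ultimately show ?thesis using inv by simp
    qed
    then have "u \<theta> = u 0"
      using \<theta> \<tau>0 \<tau>
      by (intro has_derivative_zero_unique[of "{- \<tau>..0}" u]) (auto simp: has_vector_derivative_def)
    then have "exp (- z * of_real \<theta>) * \<phi> \<theta> r = \<phi> 0 r"
      using G(1,3) \<theta> by (simp add: u_def)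
    then have "exp (z * of_real \<theta>) * \<phi> 0 r
        = exp (z * of_real \<theta>) * (exp (- z * of_real \<theta>) * \<phi> \<theta> r)"
      by (simp only:)
    also have "\<dots> = (exp (- z * of_real \<theta>) * exp (z * of_real \<theta>)) * \<phi> \<theta> r"
      by (simp only: mult_ac)
    finally show ?thesis unfolding inv by simp
  qed
  show ?thesis
  proof (intro bexI ballI)
    show "\<phi> 0 \<in> Y_space a b" using X(1) \<tau> by (auto simp: X_space_def PiE_iff)
    fix r assume r: "r \<in> Omega_bar a b"
    have "DG0 a b \<tau>0 dS chat \<xi> \<phi> r = K_op a b \<tau>0 dS chat \<xi> z (\<phi> 0) r"
      using tail by (intro DG0_exp[OF r]) (simp add: \<tau>_def)
    then show "Delta_op a b \<alpha> \<tau>0 dS chat \<xi> z (\<phi> 0) r = g r"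
      using bc[OF r] ode[OF _ r, of 0] \<tau> G(2) by (simp add: Delta_op_def algebra_simps)
  qed
qed

text \<open>At $z=-\alpha$ the operator $\Delta(z)$ is $-K(z)$, whose values are differentiable in
  \<open>x\<close>.  It therefore misses the continuous function $(x,y)\mapsto|x|$, although it would have to
  be onto.\<close>
lemma resolvent_set_avoids_minus_alpha:
  assumes ab: "a > 0" "b > 0" and \<tau>0: "\<tau>0 > 0"
    and z: "z \<in> A_resolvent_set a b \<alpha> \<tau>0 dS chat \<xi>"
  shows "z + of_real \<alpha> \<noteq> 0"
proof
  assume "z + of_real \<alpha> = 0"
  define g :: "real \<times> real \<Rightarrow> complex" where "g = (\<lambda>r\<in>Omega_bar a b. of_real \<bar>fst r\<bar>)"
  have "g \<in> Y_space a b"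
    unfolding Y_space_def g_def
    by (auto intro!: continuous_intros cong: continuous_on_cong)
  then obtain q where q: "q \<in> Y_space a b"
    "\<And>r. r \<in> Omega_bar a b \<Longrightarrow> Delta_op a b \<alpha> \<tau>0 dS chat \<xi> z q r = g r"
    using Delta_surjective_on_resolvent_set[OF ab \<tau>0 z] by blast
  define h where "h s = Re (- K_op a b \<tau>0 dS chat \<xi> z q (s, 0))" for s
  have "(\<lambda>s. K_op a b \<tau>0 dS chat \<xi> z q (s, 0)) differentiable (at 0)"
    using q(1) ab by (intro K_op_differentiable_fst) (auto simp: Y_space_def)
  then obtain D where "((\<lambda>s. K_op a b \<tau>0 dS chat \<xi> z q (s, 0)) has_vector_derivative D) (at 0)"
    by (auto simp: vector_derivative_works)
  then have "((\<lambda>s. - K_op a b \<tau>0 dS chat \<xi> z q (s, 0)) has_vector_derivative - D) (at 0)"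
    by (rule has_vector_derivative_minus)
  then have h': "(h has_vector_derivative Re (- D)) (at 0)"
    unfolding h_def
    by (rule bounded_linear.has_vector_derivative[OF bounded_linear_Re])
  have h: "h s = \<bar>s\<bar>" if "s \<in> {- a..a}" for s
    using q(2)[of "(s, 0)"] that ab \<open>z + of_real \<alpha> = 0\<close>
    by (simp add: h_def g_def Delta_op_def cbox_Pair_eq del: uminus_complex.sel)
  \<comment> \<open>On \<open>{l..u}\<close>, one side of zero, the absolute value is \<open>d * s\<close> with \<open>d\<close> either \<open>1\<close> or \<open>- 1\<close>.\<close>
  have *: "Re (- D) = d"
    if "l < u" "0 \<in> {l..u}" "{l..u} \<subseteq> {- a..a}" "\<And>s. s \<in> {l..u} \<Longrightarrow> \<bar>s\<bar> = d * s" for d l u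
  proof (rule vector_derivative_unique_within_closed_interval[of l u 0])
    show "l < u" "0 \<in> cbox l u" using that by auto
    show "((\<lambda>s. d * s) has_vector_derivative Re (- D)) (at 0 within cbox l u)"
      using that h
      by (intro has_vector_derivative_transform[OF _ _ has_vector_derivative_at_within[OF h']]) auto
    show "((\<lambda>s. d * s) has_vector_derivative d) (at 0 within cbox l u)"
      by (auto intro!: derivative_eq_intros)
  qed
  have "Re (- D) = 1" using ab by (intro *[of 0 a]) auto
  moreover have "Re (- D) = - 1" using ab by (intro *[of "- a" 0]) auto
  ultimately show False by simp
qed

section \<open>Boundedness in mean square and expansions\<close>

lemma continuous_set_integrable_power2:
  assumes "continuous_on (cbox p q) (f :: 'a::euclidean_space \<Rightarrow> complex)"
  shows "set_integrable lborel (box p q) (\<lambda>x. (norm (f x))\<^sup>2)"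
    and "set_integrable lborel (box p q) (\<lambda>x. norm (f x))"
proof -
  have *: "set_integrable lborel (box p q) h" if "continuous_on (cbox p q) h" for h :: "'a \<Rightarrow> real"
  proof (rule set_integrable_subset)
    show "set_integrable lborel (cbox p q) h"
      unfolding set_integrable_def by (rule borel_integrable_compact[OF compact_cbox that])
  qed (auto simp: box_subset_cbox)
  show "set_integrable lborel (box p q) (\<lambda>x. (norm (f x))\<^sup>2)"
    and "set_integrable lborel (box p q) (\<lambda>x. norm (f x))"
    by (intro * continuous_intros assms)+
qed

lemma continuous_in_L2:
  assumes "continuous_on (Omega_bar a b) f"
  shows "f \<in> L2 (Omega a b)"
  using set_integral_box_continuous(1)[OF assms] continuous_set_integrable_power2(1)[OF assms]
  by (auto simp: L2_def set_integrable_def set_borel_measurable_def dest: borel_measurable_integrable)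

lemma L2_norm_cong:
  assumes "\<And>r. r \<in> Omega a b \<Longrightarrow> f r = h r"
  shows "L2_norm (Omega a b) f = L2_norm (Omega a b) h"
  unfolding L2_norm_def using assms by (intro arg_cong[where f = sqrt] set_lebesgue_integral_cong) auto

lemma L2_norm_power2:
  "(L2_norm S f)\<^sup>2 = (LINT r:S|lborel. (norm (f r))\<^sup>2)"
  unfolding L2_norm_def set_lebesgue_integral_def by (simp add: integral_nonneg_AE)

lemma set_integral_const_Omega:
  "set_integrable lborel (Omega a b) (\<lambda>_. C :: real)"
  "(LINT r:Omega a b|lborel. C) = measure lborel (Omega a b) * C"
proof -
  have fin: "emeasure lborel (Omega a b) < \<infinity>"
    by (rule emeasure_bounded_finite) (rule bounded_box)
  then show "set_integrable lborel (Omega a b) (\<lambda>_. C)"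
    by (simp add: set_integrable_def)
  show "(LINT r:Omega a b|lborel. C) = measure lborel (Omega a b) * C"
    using fin by (simp add: set_lebesgue_integral_def)
qed

text \<open>The Cauchy--Schwarz inequality against the constant one, read off from the nonnegativity
  of the variance of \<open>norm f\<close>.\<close>
lemma L1_le_L2_norm:
  assumes ab: "a > 0" "b > 0" and f: "continuous_on (Omega_bar a b) f"
  defines "V \<equiv> measure lborel (Omega a b)"
  shows "(LINT r:Omega a b|lborel. norm (f r))\<^sup>2 \<le> V * (L2_norm (Omega a b) f)\<^sup>2"
proof -
  define I where "I = (LINT r:Omega a b|lborel. norm (f r))"
  have V: "V > 0"
  proof -
    have "V = measure lborel (Omega_bar a b)"
      by (simp only: V_def measure_lborel_box_eq measure_lborel_cbox_eq)
    then show ?thesis using ab by (simp add: content_Pair)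
  qed
  note int = continuous_set_integrable_power2[OF f] set_integral_const_Omega
  have "0 \<le> (LINT r:Omega a b|lborel. (norm (f r) - I / V)\<^sup>2)"
    by (simp add: set_lebesgue_integral_def integral_nonneg_AE)
  also have "\<dots> = (LINT r:Omega a b|lborel. ((norm (f r))\<^sup>2 - 2 * (I / V) * norm (f r)) + (I / V)\<^sup>2)"
    by (simp add: power2_diff algebra_simps)
  also have "\<dots> = (L2_norm (Omega a b) f)\<^sup>2 - 2 * (I / V) * I + V * (I / V)\<^sup>2"
    using int by (simp add: set_integral_add set_integral_diff L2_norm_power2 I_def V_def)
  also have "\<dots> = (L2_norm (Omega a b) f)\<^sup>2 - I\<^sup>2 / V"
    using V by (simp add: field_simps power2_eq_square)
  finally show ?thesis
    using V by (simp add: I_def field_simps)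
qed

lemma norm_K_op_le:
  assumes f: "continuous_on (Omega_bar a b) f" and r: "r \<in> Omega_bar a b"
  shows "norm (K_op a b \<tau>0 dS chat \<xi> z f r) \<le> norm (c_fun \<tau>0 dS chat z) *
    (exp (norm (k_fun \<xi> z) * (2 * a + 2 * b)) * (LINT r:Omega a b|lborel. norm (f r)))"
proof -
  let ?h = "\<lambda>r'. exp (- k_fun \<xi> z * of_real (norm1 (r - r'))) * f r'"
  have h: "continuous_on (Omega_bar a b) ?h"
    by (intro continuous_intros continuous_on_kernel f)
  have "norm (LINT r':Omega a b|lborel. ?h r') \<le> (LINT r':Omega a b|lborel. norm (?h r'))"
    using integral_norm_bound[of lborel "\<lambda>r'. indicator (Omega a b) r' *\<^sub>R ?h r'"]
    by (simp add: set_lebesgue_integral_def)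
  also have "\<dots> \<le> (LINT r':Omega a b|lborel. exp (norm (k_fun \<xi> z) * (2 * a + 2 * b)) * norm (f r'))"
  proof (rule set_integral_mono)
    fix r' assume "r' \<in> Omega a b"
    then have "r' \<in> Omega_bar a b" by (rule Omega_imp_Omega_bar)
    then show "norm (?h r') \<le> exp (norm (k_fun \<xi> z) * (2 * a + 2 * b)) * norm (f r')"
      unfolding norm_mult by (intro mult_right_mono norm_kernel_le r) auto
  qed (use continuous_set_integrable_power2(2)[OF f] continuous_set_integrable_power2(2)[OF h] in auto)
  finally show ?thesis
    unfolding K_op_def norm_mult by (intro mult_left_mono) auto
qed

text \<open>The kernel is bounded on a bounded domain, so $K(z)$ maps $L^1$, and a fortiori $L^2$,
  boundedly into bounded functions and hence into $L^2$.  The two scalars cover both uses below: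
  $\Delta(z)$ itself and a multiple of $K(z)$.\<close>
lemma L2_norm_K_op_bounded:
  assumes ab: "a > 0" "b > 0"
  shows "\<exists>C. \<forall>f. continuous_on (Omega_bar a b) f \<longrightarrow>
    L2_norm (Omega a b) (\<lambda>r. d * f r + e * K_op a b \<tau>0 dS chat \<xi> z f r)
      \<le> C * L2_norm (Omega a b) f"
proof -
  define V where "V = measure lborel (Omega a b)"
  define B where "B = norm e * norm (c_fun \<tau>0 dS chat z) * exp (norm (k_fun \<xi> z) * (2 * a + 2 * b))"
  define C where "C = 2 * (norm d)\<^sup>2 + 2 * B\<^sup>2 * V * V"
  have "L2_norm (Omega a b) (\<lambda>r. d * f r + e * K_op a b \<tau>0 dS chat \<xi> z f r)
      \<le> sqrt C * L2_norm (Omega a b) f" if f: "continuous_on (Omega_bar a b) f" for f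
  proof -
    let ?D = "\<lambda>r. d * f r + e * K_op a b \<tau>0 dS chat \<xi> z f r"
    define I where "I = (LINT r:Omega a b|lborel. norm (f r))"
    have B: "B \<ge> 0" by (simp add: B_def)
    have C: "C \<ge> 0" by (simp add: C_def V_def)
    have N: "L2_norm (Omega a b) f \<ge> 0"
      by (simp add: L2_norm_def set_lebesgue_integral_def integral_nonneg_AE)
    have I: "I\<^sup>2 \<le> V * (L2_norm (Omega a b) f)\<^sup>2"
      using L1_le_L2_norm[OF ab f] by (simp add: I_def V_def)
    have bound: "(norm (?D r))\<^sup>2 \<le> 2 * (norm d)\<^sup>2 * (norm (f r))\<^sup>2 + 2 * B\<^sup>2 * I\<^sup>2"
      if "r \<in> Omega a b" for r
    proof -
      have "r \<in> Omega_bar a b" using that by (rule Omega_imp_Omega_bar)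
      from norm_K_op_le[OF f this]
      have "norm (e * K_op a b \<tau>0 dS chat \<xi> z f r) \<le> B * I"
        unfolding norm_mult B_def I_def mult.assoc by (intro mult_left_mono) auto
      then have "norm (?D r) \<le> norm d * norm (f r) + B * I"
        using norm_triangle_ineq[of "d * f r" "e * K_op a b \<tau>0 dS chat \<xi> z f r"]
        by (simp add: norm_mult)
      then have "(norm (?D r))\<^sup>2 \<le> (norm d * norm (f r) + B * I)\<^sup>2"
        by (intro power_mono) auto
      also have "\<dots> \<le> 2 * (norm d * norm (f r))\<^sup>2 + 2 * (B * I)\<^sup>2"
        using zero_le_power2[of "norm d * norm (f r) - B * I"]
        unfolding power2_sum power2_diff by linarith
      finally show ?thesis by (simp add: power_mult_distrib)
    qed
    note int = continuous_set_integrable_power2[OF f] set_integral_const_Omega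
    have R: "set_integrable lborel (Omega a b)
        (\<lambda>r. 2 * (norm d)\<^sup>2 * (norm (f r))\<^sup>2 + 2 * B\<^sup>2 * I\<^sup>2)"
      using int by (intro set_integral_add) auto
    have "(LINT r:Omega a b|lborel. (norm (?D r))\<^sup>2)
        \<le> (LINT r:Omega a b|lborel. 2 * (norm d)\<^sup>2 * (norm (f r))\<^sup>2 + 2 * B\<^sup>2 * I\<^sup>2)"
    proof (cases "set_integrable lborel (Omega a b) (\<lambda>r. (norm (?D r))\<^sup>2)")
      case True
      then show ?thesis by (rule set_integral_mono[OF _ R bound])
    next
      case False
      then have "(LINT r:Omega a b|lborel. (norm (?D r))\<^sup>2) = 0"
        by (simp add: set_integrable_def set_lebesgue_integral_def not_integrable_integral_eq)
      also have "0 \<le> (LINT r:Omega a b|lborel. 2 * (norm d)\<^sup>2 * (norm (f r))\<^sup>2 + 2 * B\<^sup>2 * I\<^sup>2)"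
        by (simp add: set_lebesgue_integral_def integral_nonneg_AE)
      finally show ?thesis .
    qed
    also have "\<dots> = 2 * (norm d)\<^sup>2 * (L2_norm (Omega a b) f)\<^sup>2 + V * (2 * B\<^sup>2 * I\<^sup>2)"
      using int by (simp add: set_integral_add L2_norm_power2 V_def)
    also have "\<dots> \<le> 2 * (norm d)\<^sup>2 * (L2_norm (Omega a b) f)\<^sup>2
        + V * (2 * B\<^sup>2 * (V * (L2_norm (Omega a b) f)\<^sup>2))"
      using I by (intro add_left_mono mult_left_mono) (auto simp: V_def)
    also have "\<dots> = C * (L2_norm (Omega a b) f)\<^sup>2"
      by (simp add: C_def algebra_simps)
    finally have "L2_norm (Omega a b) ?D \<le> sqrt (C * (L2_norm (Omega a b) f)\<^sup>2)"
      unfolding L2_norm_def[of _ ?D] by (rule real_sqrt_le_mono)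
    then show ?thesis
      using N by (simp add: real_sqrt_mult)
  qed
  then show ?thesis by blast
qed

lemma L2_basis_coefficients_unique:
  assumes basis: "L2_basis F S e"
    and \<eta>: "L2_sums F S (\<lambda>m n r. \<eta> m n * e m n r) f"
    and \<eta>': "L2_sums F S (\<lambda>m n r. \<eta>' m n * e m n r) f"
  shows "\<eta> = \<eta>'"
proof -
  have "f \<in> L2 S" using \<eta> by (simp add: L2_sums_def)
  then have "\<exists>!\<eta>. L2_sums F S (\<lambda>m n r. \<eta> m n * e m n r) f"
    using basis by (simp add: L2_basis_def)
  then obtain \<zeta> where unique: "\<forall>\<eta>. L2_sums F S (\<lambda>m n r. \<eta> m n * e m n r) f \<longrightarrow> \<eta> = \<zeta>"
    by (rule ex1E) (rule that)
  show ?thesis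
    using unique[rule_format, OF \<eta>] unique[rule_format, OF \<eta>'] by simp
qed

lemma L2_basis_expansion:
  assumes "L2_basis F S e" "f \<in> L2 S"
  shows "\<exists>\<eta>. L2_sums F S (\<lambda>m n r. \<eta> m n * e m n r) f"
  using assms unfolding L2_basis_def by (intro ex1_implies_ex) simp

text \<open>A basis function that vanished on $\Omega$ could be given any coefficient in an expansion
  of zero.\<close>
lemma L2_basis_not_zero:
  assumes basis: "L2_basis F (Omega a b) e"
    and cont: "\<And>m n. continuous_on (Omega_bar a b) (e m n)"
  shows "\<exists>r\<in>Omega a b. e m n r \<noteq> 0"
proof (rule ccontr)
  assume "\<not> (\<exists>r\<in>Omega a b. e m n r \<noteq> 0)"
  then have zero: "e m n r = 0" if "r \<in> Omega a b" for r using that by blast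
  have sums: "L2_sums F (Omega a b) (\<lambda>i j r. (if (i, j) = (m, n) then d else 0) * e i j r) (\<lambda>_. 0)" for d
  proof -
    have "L2_norm (Omega a b)
        (\<lambda>r. (\<Sum>(i, j)\<in>N. (if (i, j) = (m, n) then d else 0) * e i j r) - 0) = 0" for N
    proof -
      have "L2_norm (Omega a b)
          (\<lambda>r. (\<Sum>(i, j)\<in>N. (if (i, j) = (m, n) then d else 0) * e i j r) - 0)
        = L2_norm (Omega a b) (\<lambda>_. 0)"
        by (intro L2_norm_cong) (auto intro!: sum.neutral simp: zero)
      also have "\<dots> = 0" by (simp add: L2_norm_def set_lebesgue_integral_def)
      finally show ?thesis .
    qed
    then show ?thesis
      unfolding L2_sums_def by (auto intro!: continuous_in_L2 continuous_on_mult_left cont)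
  qed
  have "(\<lambda>i j. if (i, j) = (m, n) then 0 else 0)
      = (\<lambda>i j. if (i, j) = (m, n) then 1 else 0 :: complex)"
    by (rule L2_basis_coefficients_unique[OF basis sums[of 0] sums[of 1]])
  from fun_cong[OF fun_cong[OF this, of m], of n] show False by simp
qed

section \<open>Solution by expansion in eigenfunctions\<close>

lemma continuous_on_tensor:
  assumes "C2_on {- a..a} f" "C2_on {- b..b} h"
  shows "continuous_on (Omega_bar a b) (tensor f h)"
proof -
  have C: "continuous_on I f" if "C2_on I f" for I f
    using that unfolding C2_on_def
    by (auto simp: continuous_on_eq_continuous_within intro: has_vector_derivative_continuous)
  show ?thesis
    unfolding tensor_def split_beta
    by (intro continuous_intros continuous_on_compose2[OF C[OF assms(1)]]
        continuous_on_compose2[OF C[OF assms(2)]]) (auto simp: cbox_Pair_eq)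
qed

text \<open>Apply $K(z)$ to the eigenvalue equation of \<open>L_op\<close>, commute, and use $L(z)K(z)=4c(z)k^2(z)$:
  the eigenfunctions of $L(z)$ with eigenvalue \<open>l\<close> are eigenfunctions of $K(z)$ with eigenvalue
  $4c(z)k^2(z)/l$.\<close>
lemma K_op_eigenvalue:
  assumes ab: "a > 0" "b > 0" and t: "continuous_on (Omega_bar a b) t"
    and eigen: "\<forall>r\<in>Omega_bar a b. L_op a b \<xi> z t r = l * t r" and "l \<noteq> 0"
    and comm: "\<forall>r\<in>Omega_bar a b.
      K_op a b \<tau>0 dS chat \<xi> z (L_op a b \<xi> z t) r - L_op a b \<xi> z (K_op a b \<tau>0 dS chat \<xi> z t) r = 0"
    and r: "r \<in> Omega_bar a b"
  shows "K_op a b \<tau>0 dS chat \<xi> z t r = 4 * c_fun \<tau>0 dS chat z * (k_fun \<xi> z)\<^sup>2 / l * t r"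
proof -
  have "l * K_op a b \<tau>0 dS chat \<xi> z t r = K_op a b \<tau>0 dS chat \<xi> z (L_op a b \<xi> z t) r"
    unfolding K_op_mult[symmetric] using eigen
    by (intro K_op_cong) (simp add: Omega_imp_Omega_bar)
  also have "\<dots> = L_op a b \<xi> z (K_op a b \<tau>0 dS chat \<xi> z t) r"
    using comm r by simp
  also have "\<dots> = 4 * c_fun \<tau>0 dS chat z * (k_fun \<xi> z)\<^sup>2 * t r"
    by (rule L_op_K_op[OF ab t r])
  finally show ?thesis using \<open>l \<noteq> 0\<close> by (simp add: field_simps)
qed

text \<open>A combination of the identity and $K(z)$ may be applied to an expansion term by term,
  since it is linear and bounded in mean square.  Every partial sum minus its limit is a continuous
  function, so the bound for continuous functions suffices, and convergence is inherited along
  whatever filter governs the summation.\<close>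
lemma K_op_L2_sums:
  assumes ab: "a > 0" "b > 0"
    and e: "\<And>m n. continuous_on (Omega_bar a b) (e m n)"
    and \<mu>: "\<And>m n r. r \<in> Omega a b \<Longrightarrow> K_op a b \<tau>0 dS chat \<xi> z (e m n) r = \<mu> m n * e m n r"
    and q: "continuous_on (Omega_bar a b) q"
    and sums: "L2_sums F (Omega a b) (\<lambda>m n r. \<eta> m n * e m n r) q"
    and p: "continuous_on (Omega_bar a b) p"
    and p_eq: "\<And>r. r \<in> Omega a b \<Longrightarrow> p r = d1 * q r + d2 * K_op a b \<tau>0 dS chat \<xi> z q r"
  shows "L2_sums F (Omega a b) (\<lambda>m n r. \<eta> m n * (d1 + d2 * \<mu> m n) * e m n r) p"
proof -
  let ?K = "K_op a b \<tau>0 dS chat \<xi> z"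
  let ?rem = "\<lambda>N r. (\<Sum>(m, n)\<in>N. \<eta> m n * e m n r) - q r"
  obtain C where C: "\<And>f. continuous_on (Omega_bar a b) f \<Longrightarrow>
      L2_norm (Omega a b) (\<lambda>r. d1 * f r + d2 * ?K f r) \<le> C * L2_norm (Omega a b) f"
    using L2_norm_K_op_bounded[OF ab] by blast
  have rem: "continuous_on (Omega_bar a b) (?rem N)" for N
    unfolding split_beta by (intro continuous_intros e q)
  have K_rem: "?K (?rem N) r = (\<Sum>(m, n)\<in>N. \<eta> m n * (\<mu> m n * e m n r)) - ?K q r"
    if r: "r \<in> Omega a b" for r N
  proof -
    have r': "r \<in> Omega_bar a b" using r by (rule Omega_imp_Omega_bar)
    have int: "set_integrable lborel (Omega a b) (\<lambda>r. \<eta> m n * e m n r)" for m n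
      by (intro set_integral_box_continuous continuous_intros e)
    have sum: "set_integrable lborel (Omega a b) (\<lambda>r. \<Sum>(m, n)\<in>N. \<eta> m n * e m n r)"
      unfolding split_beta by (intro set_integral_box_continuous continuous_intros e)
    have "?K (?rem N) r = ?K (\<lambda>r. \<Sum>(m, n)\<in>N. \<eta> m n * e m n r) r - ?K q r"
      by (intro K_op_diff sum set_integral_box_continuous q r')
    also have "?K (\<lambda>r. \<Sum>(m, n)\<in>N. \<eta> m n * e m n r) r
        = (\<Sum>(m, n)\<in>N. ?K (\<lambda>r. \<eta> m n * e m n r) r)"
      unfolding split_beta by (rule K_op_sum[OF int r'])
    also have "\<dots> = (\<Sum>(m, n)\<in>N. \<eta> m n * (\<mu> m n * e m n r))"
      unfolding K_op_mult \<mu>[OF r] ..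
    finally show ?thesis .
  qed
  have "L2_norm (Omega a b) (\<lambda>r. (\<Sum>(m, n)\<in>N. \<eta> m n * (d1 + d2 * \<mu> m n) * e m n r) - p r)
      \<le> C * L2_norm (Omega a b) (?rem N)" for N
  proof -
    have "(\<Sum>(m, n)\<in>N. \<eta> m n * (d1 + d2 * \<mu> m n) * e m n r) - p r
        = d1 * ?rem N r + d2 * ?K (?rem N) r" if r: "r \<in> Omega a b" for r
    proof -
      have "(\<Sum>(m, n)\<in>N. \<eta> m n * (d1 + d2 * \<mu> m n) * e m n r)
          = d1 * (\<Sum>(m, n)\<in>N. \<eta> m n * e m n r) + d2 * (\<Sum>(m, n)\<in>N. \<eta> m n * (\<mu> m n * e m n r))"
        unfolding sum_distrib_left sum.distrib[symmetric] split_beta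
        by (intro sum.cong refl) (simp add: algebra_simps)
      then show ?thesis
        unfolding K_rem[OF r] p_eq[OF r] by (simp only: right_diff_distrib) simp
    qed
    then have "L2_norm (Omega a b) (\<lambda>r. (\<Sum>(m, n)\<in>N. \<eta> m n * (d1 + d2 * \<mu> m n) * e m n r) - p r)
        = L2_norm (Omega a b) (\<lambda>r. d1 * ?rem N r + d2 * ?K (?rem N) r)"
      by (rule L2_norm_cong)
    also have "\<dots> \<le> C * L2_norm (Omega a b) (?rem N)" by (rule C[OF rem])
    finally show ?thesis .
  qed
  moreover have "0 \<le> L2_norm (Omega a b) f" for f
    by (simp add: L2_norm_def set_lebesgue_integral_def integral_nonneg_AE)
  ultimately have bound: "\<forall>\<^sub>F N in F. norm (L2_norm (Omega a b)
      (\<lambda>r. (\<Sum>(m, n)\<in>N. \<eta> m n * (d1 + d2 * \<mu> m n) * e m n r) - p r))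
        \<le> C * L2_norm (Omega a b) (?rem N)"
    by (simp add: always_eventually)
  have "((\<lambda>N. C * L2_norm (Omega a b) (?rem N)) \<longlongrightarrow> 0) F"
    using sums unfolding L2_sums_def by (elim conjE) (rule tendsto_mult_right_zero)
  with bound have lim: "((\<lambda>N. L2_norm (Omega a b)
      (\<lambda>r. (\<Sum>(m, n)\<in>N. \<eta> m n * (d1 + d2 * \<mu> m n) * e m n r) - p r)) \<longlongrightarrow> 0) F"
    by (rule Lim_null_comparison)
  have mem: "(\<lambda>r. \<eta> m n * (d1 + d2 * \<mu> m n) * e m n r) \<in> L2 (Omega a b)" for m n
    by (intro continuous_in_L2 continuous_on_mult_left e)
  show ?thesis
    unfolding L2_sums_def by (intro conjI allI mem lim continuous_in_L2[OF p])
qed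

theorem proposition4p12:
  fixes a b \<alpha> \<tau>0 dS :: real
    and chat \<xi> z :: complex
    and g :: "real \<times> real \<Rightarrow> complex"
    and \<phi> \<psi> :: "nat \<Rightarrow> real \<Rightarrow> complex"
    and \<rho> \<nu> :: "nat \<Rightarrow> complex"
    and coef :: "nat \<Rightarrow> nat \<Rightarrow> complex"
    and F :: "(nat \<times> nat) set filter"
  defines "k \<equiv> k_fun \<xi> z"
    and "c \<equiv> c_fun \<tau>0 dS chat z"
    and "K \<equiv> K_op a b \<tau>0 dS chat \<xi> z"
    and "L \<equiv> L_op a b \<xi> z"
    and "\<Delta> \<equiv> Delta_op a b \<alpha> \<tau>0 dS chat \<xi> z"
    and "P \<equiv> P_fun \<alpha> \<tau>0 dS chat \<xi> z"
  assumes "a > 0" and "b > 0" and "\<alpha> > 0" and "\<tau>0 > 0" and "dS \<noteq> 0" and "chat \<noteq> 0"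
    and J_real: "\<forall>r \<in> Omega_bar a b. \<forall>r' \<in> Omega_bar a b. J chat \<xi> r r' \<in> \<real>"
    and z_resolvent: "z \<in> A_resolvent_set a b \<alpha> \<tau>0 dS chat \<xi>"
    and "k \<noteq> 0"
    and "g \<in> Y_space a b"
    and "\<forall>m. C2_on {- a..a} (\<phi> m)"
    and "\<forall>n. C2_on {- b..b} (\<psi> n)"
    and "summation_order F"
    and basis: "L2_basis F (Omega a b) (\<lambda>m n. tensor (\<phi> m) (\<psi> n))"
    and "\<forall>m. k\<^sup>2 \<noteq> (\<rho> m)\<^sup>2"
    and "\<forall>n. k\<^sup>2 \<noteq> (\<nu> n)\<^sup>2"
    and L_eigen: "\<forall>m n. \<forall>r \<in> Omega_bar a b.
        L (tensor (\<phi> m) (\<psi> n)) r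
          = (k\<^sup>2 - (\<rho> m)\<^sup>2) * (k\<^sup>2 - (\<nu> n)\<^sup>2) * tensor (\<phi> m) (\<psi> n) r"
    and KL_commute: "\<forall>m n. \<forall>r \<in> Omega_bar a b.
        K (L (tensor (\<phi> m) (\<psi> n))) r - L (K (tensor (\<phi> m) (\<psi> n))) r = 0"
    and g_expansion:
      "L2_sums F (Omega a b) (\<lambda>m n r. coef m n * tensor (\<phi> m) (\<psi> n) r) g"
  shows "(\<exists>!q. q \<in> Y_space a b \<and> (\<forall>r \<in> Omega_bar a b. \<Delta> q r = g r)) \<and>
    z + of_real \<alpha> \<noteq> 0 \<and> (\<forall>n m. P (\<rho> n) (\<nu> m) \<noteq> 0) \<and>
    (\<forall>q. q \<in> Y_space a b \<and> (\<forall>r \<in> Omega_bar a b. \<Delta> q r = g r) \<longrightarrow>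
      (\<exists>s. L2_sums F (Omega a b)
             (\<lambda>n m r. coef n m / P (\<rho> n) (\<nu> m) * tensor (\<phi> n) (\<psi> m) r) s \<and>
           (AE r in lborel. r \<in> Omega a b \<longrightarrow>
              q r = g r / (z + of_real \<alpha>) + 4 * c * k\<^sup>2 / (z + of_real \<alpha>) * s r)))"
proof -
  note ab = \<open>a > 0\<close> \<open>b > 0\<close> and \<tau>0 = \<open>\<tau>0 > 0\<close>
  define e where "e m n = tensor (\<phi> m) (\<psi> n)" for m n
  define l where "l m n = (k\<^sup>2 - (\<rho> m)\<^sup>2) * (k\<^sup>2 - (\<nu> n)\<^sup>2)" for m n
  have P_l: "P (\<rho> m) (\<nu> n) = (z + of_real \<alpha>) * l m n - 4 * c * k\<^sup>2" for m n
    unfolding P_def P_fun_def l_def k_def c_def by (simp only: mult.assoc)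
  have l: "l m n \<noteq> 0" for m n
    unfolding l_def
    using \<open>\<forall>m. k\<^sup>2 \<noteq> (\<rho> m)\<^sup>2\<close>[rule_format, of m] \<open>\<forall>n. k\<^sup>2 \<noteq> (\<nu> n)\<^sup>2\<close>[rule_format, of n]
    by (simp only: mult_eq_0_iff right_minus_eq) simp
  have ck: "c * k\<^sup>2 \<noteq> 0"
    using \<open>k \<noteq> 0\<close> \<open>dS \<noteq> 0\<close> \<open>chat \<noteq> 0\<close> by (simp add: c_def c_fun_def)
  have z\<alpha>: "z + of_real \<alpha> \<noteq> 0"
    by (rule resolvent_set_avoids_minus_alpha[OF ab \<tau>0 z_resolvent])
  have e: "continuous_on (Omega_bar a b) (e m n)" for m n
    unfolding e_def using \<open>\<forall>m. C2_on {- a..a} (\<phi> m)\<close> \<open>\<forall>n. C2_on {- b..b} (\<psi> n)\<close>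
    by (intro continuous_on_tensor) simp_all
  have eigen: "\<forall>r\<in>Omega_bar a b. L_op a b \<xi> z (e m n) r = l m n * e m n r" for m n
    using L_eigen[rule_format, of _ m n] unfolding L_def e_def l_def by (rule ballI)
  have commute: "\<forall>r\<in>Omega_bar a b. K_op a b \<tau>0 dS chat \<xi> z (L_op a b \<xi> z (e m n)) r
      - L_op a b \<xi> z (K_op a b \<tau>0 dS chat \<xi> z (e m n)) r = 0" for m n
    using KL_commute[rule_format, of _ m n] unfolding K_def L_def e_def by (rule ballI)
  have K_e: "K (e m n) r = 4 * c * k\<^sup>2 / l m n * e m n r" if "r \<in> Omega_bar a b" for m n r
    unfolding K_def c_def k_def
    by (rule K_op_eigenvalue[OF ab e eigen l commute that])
  have gc: "continuous_on (Omega_bar a b) g"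
    using \<open>g \<in> Y_space a b\<close> by (simp add: Y_space_def)

  \<comment> \<open>On basis functions \<open>\<Delta>\<close> is multiplication by \<open>P / l\<close>, so a zero of \<open>P\<close> would contradict
      injectivity.\<close>
  have P: "P (\<rho> m) (\<nu> n) \<noteq> 0" for m n
  proof
    assume P0: "P (\<rho> m) (\<nu> n) = 0"
    define q where "q = restrict (e m n) (Omega_bar a b)"
    have q: "q \<in> Y_space a b"
      using e[of m n] by (auto simp: Y_space_def q_def cong: continuous_on_cong)
    have "4 * c * k\<^sup>2 / l m n = z + of_real \<alpha>"
      using P0 l[of m n] by (simp add: P_l field_simps)
    have "\<forall>r\<in>Omega_bar a b. Delta_op a b \<alpha> \<tau>0 dS chat \<xi> z q r = 0"
    proof
      fix r assume r: "r \<in> Omega_bar a b"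
      have "K_op a b \<tau>0 dS chat \<xi> z q r = K (e m n) r"
        unfolding K_def by (intro K_op_cong) (simp add: q_def Omega_imp_Omega_bar)
      also have "\<dots> = (z + of_real \<alpha>) * e m n r"
        unfolding K_e[OF r] \<open>4 * c * k\<^sup>2 / l m n = z + of_real \<alpha>\<close> ..
      finally show "Delta_op a b \<alpha> \<tau>0 dS chat \<xi> z q r = 0" using r by (simp add: Delta_op_def q_def)
    qed
    from Delta_injective_on_resolvent_set[OF ab \<tau>0 z_resolvent q this]
    have "q r = 0" if "r \<in> Omega_bar a b" for r
      using that .
    then have "e m n r = 0" if "r \<in> Omega a b" for r
      using \<open>\<And>r. r \<in> Omega_bar a b \<Longrightarrow> q r = 0\<close>[OF Omega_imp_Omega_bar[OF that]]
        Omega_imp_Omega_bar[OF that] by (simp add: q_def)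
    moreover have "\<exists>r\<in>Omega a b. e m n r \<noteq> 0"
      using basis unfolding e_def[symmetric] by (rule L2_basis_not_zero) (rule e)
    ultimately show False by blast
  qed

  have unique: "\<exists>!q. q \<in> Y_space a b \<and> (\<forall>r\<in>Omega_bar a b. \<Delta> q r = g r)"
  proof (rule ex_ex1I)
    show "\<exists>q. q \<in> Y_space a b \<and> (\<forall>r\<in>Omega_bar a b. \<Delta> q r = g r)"
      using Delta_surjective_on_resolvent_set[OF ab \<tau>0 z_resolvent \<open>g \<in> Y_space a b\<close>]
      unfolding \<Delta>_def by blast
    fix q q'
    assume q: "q \<in> Y_space a b \<and> (\<forall>r\<in>Omega_bar a b. \<Delta> q r = g r)"
      and q': "q' \<in> Y_space a b \<and> (\<forall>r\<in>Omega_bar a b. \<Delta> q' r = g r)"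
    have qc: "continuous_on (Omega_bar a b) q" "continuous_on (Omega_bar a b) q'"
      using q q' by (auto simp: Y_space_def)
    define h where "h = (\<lambda>r\<in>Omega_bar a b. q r - q' r)"
    have h: "h \<in> Y_space a b"
      using continuous_on_diff[OF qc] by (auto simp: Y_space_def h_def cong: continuous_on_cong)
    have "\<forall>r\<in>Omega_bar a b. Delta_op a b \<alpha> \<tau>0 dS chat \<xi> z h r = 0"
      unfolding h_def using q q' by (simp add: Delta_op_diff[OF qc] \<Delta>_def)
    from Delta_injective_on_resolvent_set[OF ab \<tau>0 z_resolvent h this]
    have "q r = q' r" if "r \<in> Omega_bar a b" for r
      using that by (simp add: h_def)
    then show "q = q'"
      using q q' by (intro extensionalityI[of _ "Omega_bar a b"]) (auto simp: Y_space_def)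
  qed

  have formula: "\<exists>s. L2_sums F (Omega a b)
             (\<lambda>n m r. coef n m / P (\<rho> n) (\<nu> m) * tensor (\<phi> n) (\<psi> m) r) s \<and>
           (AE r in lborel. r \<in> Omega a b \<longrightarrow>
              q r = g r / (z + of_real \<alpha>) + 4 * c * k\<^sup>2 / (z + of_real \<alpha>) * s r)"
    if q: "q \<in> Y_space a b \<and> (\<forall>r\<in>Omega_bar a b. \<Delta> q r = g r)" for q
  proof -
    have qc: "continuous_on (Omega_bar a b) q" using q by (simp add: Y_space_def)
    have Kq: "K q r = (z + of_real \<alpha>) * q r - g r" if "r \<in> Omega a b" for r
    proof -
      have "r \<in> Omega_bar a b" using that by (rule Omega_imp_Omega_bar)
      then have "\<Delta> q r = g r" using q by blast
      then show ?thesis by (simp add: \<Delta>_def Delta_op_def K_def algebra_simps)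
    qed
    have K_e': "K_op a b \<tau>0 dS chat \<xi> z (e m n) r = 4 * c * k\<^sup>2 / l m n * e m n r"
      if "r \<in> Omega a b" for m n r
      using K_e[OF Omega_imp_Omega_bar[OF that]] by (simp add: K_def)
    obtain \<eta> where \<eta>: "L2_sums F (Omega a b) (\<lambda>m n r. \<eta> m n * e m n r) q"
      using L2_basis_expansion[OF basis[folded e_def] continuous_in_L2[OF qc]] by (rule exE)
    have g_eq: "g r = (z + of_real \<alpha>) * q r + - 1 * K_op a b \<tau>0 dS chat \<xi> z q r"
      if "r \<in> Omega a b" for r
      using Kq[OF that] by (simp add: K_def)
    have "L2_sums F (Omega a b)
        (\<lambda>m n r. \<eta> m n * ((z + of_real \<alpha>) + - 1 * (4 * c * k\<^sup>2 / l m n)) * e m n r) g"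
      by (rule K_op_L2_sums[OF ab e K_e' qc \<eta> gc g_eq])
    \<comment> \<open>Both this series and the given one represent \<open>g\<close>, which determines the coefficients of \<open>q\<close>.\<close>
    note coefficients = L2_basis_coefficients_unique[OF basis[folded e_def] this g_expansion[folded e_def]]
    have eq: "\<eta> m n * ((z + of_real \<alpha>) + - 1 * (4 * c * k\<^sup>2 / l m n)) = coef m n" for m n
      using fun_cong[OF fun_cong[OF coefficients, of m], of n] .
    have coef: "\<eta> m n * (0 + 1 / (4 * c * k\<^sup>2) * (4 * c * k\<^sup>2 / l m n)) = coef m n / P (\<rho> m) (\<nu> n)"
      for m n
    proof -
      have "(z + of_real \<alpha>) + - 1 * (4 * c * k\<^sup>2 / l m n) = P (\<rho> m) (\<nu> n) / l m n"
        unfolding P_l diff_divide_distrib using l[of m n] by simp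
      then have "coef m n = \<eta> m n * (P (\<rho> m) (\<nu> n) / l m n)"
        unfolding eq[symmetric] by (rule arg_cong)
      then show ?thesis using P[of m n] ck by simp
    qed
    \<comment> \<open>On \<open>Omega a b\<close> this is \<open>K q\<close> divided by \<open>4 * c * k\<^sup>2\<close>; written through \<open>q\<close> and \<open>g\<close> it is
        visibly continuous.\<close>
    define s where "s r = ((z + of_real \<alpha>) * q r - g r) / (4 * c * k\<^sup>2)" for r
    have s: "continuous_on (Omega_bar a b) s"
      unfolding s_def using ck by (intro continuous_intros qc gc) auto
    have s_eq: "s r = 0 * q r + 1 / (4 * c * k\<^sup>2) * K_op a b \<tau>0 dS chat \<xi> z q r"
      if "r \<in> Omega a b" for r
      using Kq[OF that] by (simp add: s_def K_def)
    have "L2_sums F (Omega a b)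
        (\<lambda>m n r. \<eta> m n * (0 + 1 / (4 * c * k\<^sup>2) * (4 * c * k\<^sup>2 / l m n)) * e m n r) s"
      by (rule K_op_L2_sums[OF ab e K_e' qc \<eta> s s_eq])
    then have "L2_sums F (Omega a b)
        (\<lambda>n m r. coef n m / P (\<rho> n) (\<nu> m) * tensor (\<phi> n) (\<psi> m) r) s"
      unfolding coef e_def .
    moreover have "q r = g r / (z + of_real \<alpha>) + 4 * c * k\<^sup>2 / (z + of_real \<alpha>) * s r" for r
    proof -
      have "4 * c * k\<^sup>2 * s r = (z + of_real \<alpha>) * q r - g r"
        using ck by (simp add: s_def)
      then have "4 * c * k\<^sup>2 / (z + of_real \<alpha>) * s r = q r - g r / (z + of_real \<alpha>)"
        using z\<alpha> by (simp only: times_divide_eq_left diff_divide_distrib) simp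
      then show ?thesis by simp
    qed
    then have "AE r in lborel. r \<in> Omega a b \<longrightarrow>
        q r = g r / (z + of_real \<alpha>) + 4 * c * k\<^sup>2 / (z + of_real \<alpha>) * s r"
      by (intro always_eventually allI impI)
    ultimately show ?thesis
      by (intro exI[of _ s] conjI)
  qed

  show ?thesis
    by (intro conjI allI impI unique z\<alpha> P) (rule formula)
qed

end
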